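(* Let $(X,\varphi)$ be a Cantor minimal system. If the commutator subgroup $D([[\varphi]])$ of the topological full group $[[\varphi]]$ is finitely generated, then $D([[\varphi]])$ has exponential growth.
   Context: A Cantor set is a non-empty compact metrizable totally disconnected space without isolated points. A Cantor minimal system $(X,\varphi)$ is a Cantor set $X$ with a homeomorphism $\varphi:X\to X$ all of whose orbits $\{\varphi^n(x)\mid n\in\mathbb{Z}\}$ are dense in $X$. Topological full group: $[[\varphi]]$ is the group (under composition) of all homeomorphisms $\psi:X\to X$ for which there exists a continuous map $c:X\to\mathbb{Z}$ such that $\psi(x)=\varphi^{c(x)}(x)$ for all $x\in X$. $D(\Gamma)$ denotes the commutator subgroup of a group $\Gamma$. A finitely generated group has exponential growth if, for some (equivalently any) finite symmetric generating set, the number $b(k)$ of elements of word length at most $k$ satisfies $\lim_{k\to\infty}b(k)^{1/k}>1$. *)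

theory Defs
  imports "HOL-Analysis.Analysis" "HOL-Algebra.Bij" "HOL-Algebra.Generated_Groups"
begin

section \<open>Cantor minimal systems\<close>

definition totally_disconnected_space :: "'a topology \<Rightarrow> bool" where
  "totally_disconnected_space X \<longleftrightarrow> (\<forall>S. connectedin X S \<longrightarrow> (\<exists>a. S \<subseteq> {a}))"

definition Cantor_set :: "'a topology \<Rightarrow> bool" where
  "Cantor_set X \<longleftrightarrow>
     topspace X \<noteq> {} \<and> compact_space X \<and> metrizable_space X \<and>
     totally_disconnected_space X \<and> (\<forall>x\<in>topspace X. \<not> openin X {x})"

text \<open>
  Self-homeomorphisms are normalised to be \<^const>\<open>undefined\<close> outside the space, as in
  \<^const>\<open>BijGroup\<close>, so that two of them are equal as soon as they agree on the space.
\<close>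

definition homeo_group :: "'a topology \<Rightarrow> ('a \<Rightarrow> 'a) monoid" where
  "homeo_group X =
     BijGroup (topspace X)\<lparr>carrier := {f \<in> Bij (topspace X). homeomorphic_map X X f}\<rparr>"

definition homeo_orbit :: "'a topology \<Rightarrow> ('a \<Rightarrow> 'a) \<Rightarrow> 'a \<Rightarrow> 'a set" where
  "homeo_orbit X \<phi> x = {(\<phi> [^]\<^bsub>homeo_group X\<^esub> n) x |n::int. True}"

definition Cantor_minimal_system :: "'a topology \<Rightarrow> ('a \<Rightarrow> 'a) \<Rightarrow> bool" where
  "Cantor_minimal_system X \<phi> \<longleftrightarrow>
     Cantor_set X \<and> \<phi> \<in> carrier (homeo_group X) \<and>
     (\<forall>x\<in>topspace X. X closure_of (homeo_orbit X \<phi> x) = topspace X)"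

definition topological_full_group :: "'a topology \<Rightarrow> ('a \<Rightarrow> 'a) \<Rightarrow> ('a \<Rightarrow> 'a) monoid" where
  "topological_full_group X \<phi> = (homeo_group X)\<lparr>carrier :=
     {\<psi> \<in> carrier (homeo_group X).
        \<exists>c :: 'a \<Rightarrow> int. continuous_map X (discrete_topology UNIV) c \<and>
          (\<forall>x\<in>topspace X. \<psi> x = (\<phi> [^]\<^bsub>homeo_group X\<^esub> c x) x)}\<rparr>"


section \<open>Groups and growth\<close>

definition commutator_subgroup :: "('a, 'b) monoid_scheme \<Rightarrow> ('a, 'b) monoid_scheme" where
  "commutator_subgroup G = G\<lparr>carrier := derived G (carrier G)\<rparr>"

definition finitely_generated_group :: "('a, 'b) monoid_scheme \<Rightarrow> bool" where
  "finitely_generated_group G \<longleftrightarrow>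
     (\<exists>S. finite S \<and> S \<subseteq> carrier G \<and> generate G S = carrier G)"

definition finite_symmetric_generating_set :: "('a, 'b) monoid_scheme \<Rightarrow> 'a set \<Rightarrow> bool" where
  "finite_symmetric_generating_set G S \<longleftrightarrow>
     finite S \<and> S \<subseteq> carrier G \<and> (\<forall>s\<in>S. inv\<^bsub>G\<^esub> s \<in> S) \<and> generate G S = carrier G"

definition word_value :: "('a, 'b) monoid_scheme \<Rightarrow> 'a list \<Rightarrow> 'a" where
  "word_value G w = foldr (mult G) w \<one>\<^bsub>G\<^esub>"

text \<open>
  Only meaningful for \<open>g\<close> in the subgroup generated by the symmetric set \<open>S\<close>,
  where the minimum is over a nonempty set.
\<close>

definition word_length :: "('a, 'b) monoid_scheme \<Rightarrow> 'a set \<Rightarrow> 'a \<Rightarrow> nat" where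
  "word_length G S g = (LEAST n. \<exists>w. set w \<subseteq> S \<and> length w = n \<and> word_value G w = g)"

definition growth_function :: "('a, 'b) monoid_scheme \<Rightarrow> 'a set \<Rightarrow> nat \<Rightarrow> nat" where
  "growth_function G S k = card {g \<in> carrier G. word_length G S g \<le> k}"

definition exponential_growth :: "('a, 'b) monoid_scheme \<Rightarrow> bool" where
  "exponential_growth G \<longleftrightarrow>
     (\<exists>S. finite_symmetric_generating_set G S \<and>
        (\<exists>L>1. (\<lambda>k. root k (real (growth_function G S k))) \<longlonglongrightarrow> L))"

end

theory Submission
  imports Defs
begin

text \<open>
  Choose a nonempty clopen set \<open>C\<close> that is disjoint from its first three translates under
  \<open>\<phi>\<close>. Let \<open>R\<close> be the first return map to \<open>C\<close>, and view \<open>C \<union> \<phi> C\<close> as two sheets over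
  \<open>C\<close>. Applying \<open>R\<close> on both sheets, or swapping the sheets over a clopen subset \<open>U\<close> of \<open>C\<close>,
  gives elements of the topological full group, and their commutators with
  \<open>\<phi>\<^sup>2\<close> lie in the commutator subgroup and act on \<open>C \<union> \<phi> C\<close> in the same way.
  If \<open>U\<close> is not periodic under \<open>R\<close>, then these two commutators generate a lamplighter group on
  \<open>C \<union> \<phi> C\<close>: a relation over the field with two elements between the indicator functions of
  the sets \<open>R\<^sup>-\<^sup>k U\<close> would force periodicity. This provides \<open>2\<^sup>n\<close> elements of word length
  \<open>O(n)\<close>.

  If every clopen subset of \<open>C\<close> were periodic under \<open>R\<close>, the cocycles of finitely many
  generators would all be invariant under some power of \<open>\<phi>\<close>, which would then centralise the
  commutator subgroup. This is impossible, since the commutator subgroup contains elements that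
  move a given point \<open>x\<close> and are supported in a small neighbourhood of finitely many points of
  its orbit.
\<close>

section \<open>Exponential growth from independent words\<close>

text \<open>Fekete's lemma in multiplicative form: the limit is the infimum of the roots. With
  \<open>n = q * m + r\<close> for a near-optimal \<open>m\<close>, the remainder contributes only a
  bounded factor, whose \<open>n\<close>-th root tends to 1.\<close>

lemma submultiplicative_root_convergent:
  fixes b :: "nat \<Rightarrow> nat"
  assumes pos: "\<And>k. b k \<ge> 1" and sub: "\<And>m n. b (m + n) \<le> b m * b n"
  shows "\<exists>L. (\<lambda>k. root k (real (b k))) \<longlonglongrightarrow> L"
proof -
  define f where "f k = root k (real (b k))" for k
  \<comment> \<open>The index 0 is left out because \<open>root 0\<close> is constantly 0.\<close>
  define L where "L = (INF k\<in>{1..}. f k)"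
  have f1: "f k \<ge> 1" if "k \<ge> 1" for k
    using that pos[of k] by (simp add: f_def)
  have bdd: "bdd_below (f ` {1..})"
    using f1 by (intro bdd_belowI[of _ 1]) auto
  have L_le: "L \<le> f k" if "k \<ge> 1" for k
    unfolding L_def using bdd that by (intro cINF_lower) auto
  have L1: "L \<ge> 1"
    unfolding L_def using f1 by (intro cINF_greatest) auto
  have mult: "b (q * m) \<le> b m ^ q" if "q \<ge> 1" for q m
    using that
  proof (induction q rule: dec_induct)
    case (step q)
    have "b (Suc q * m) \<le> b m * b (q * m)"
      using sub[of m "q * m"] by simp
    also have "\<dots> \<le> b m * b m ^ q"
      using step.IH by simp
    finally show ?case by simp
  qed simp
  have "f \<longlonglongrightarrow> L"
  proof (rule LIMSEQ_I)
    fix e :: real assume e: "e > 0"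
    obtain m where m: "m \<ge> 1" "f m < L + e / 2"
      using cINF_less_iff[of "{1..}" f "L + e/2"] bdd e L_def by auto
    \<comment> \<open>One half of \<open>e\<close> pays for the choice of \<open>m\<close>, the
      other half for the factor \<open>root n B\<close>.\<close>
    define K where "K = L + e / 2"
    have K1: "K > 1" using L1 e by (simp add: K_def)
    define B where "B = Max (b ` {..<m+m})"
    have B: "b r \<le> B" if "r < m+m" for r
      unfolding B_def using that by (intro Max_ge) auto
    have B1: "B \<ge> 1" using B[of 0] pos[of 0] m by simp
    have bm: "real (b m) \<le> K ^ m"
    proof -
      have "real (b m) = f m ^ m" using m by (simp add: f_def)
      also have "\<dots> \<le> K ^ m" using m f1[of m] unfolding K_def by (intro power_mono) auto
      finally show ?thesis .
    qed
    have main: "real (b n) \<le> K ^ n * B" if n: "n \<ge> m" for n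
    proof -
      define q r where "q = n div m" and "r = n mod m"
      have nqr: "n = q * m + r" and q: "q \<ge> 1" and r: "r < m"
        using n m by (auto simp: q_def r_def div_greater_zero_iff Suc_le_eq)
      have "b n \<le> b m ^ q * B"
        using sub[of "q * m" r] mult[OF q, of m] B[of r] r nqr
        by (meson le_trans mult_le_mono trans_less_add1)
      then have "real (b n) \<le> real (b m) ^ q * B"
        by (metis of_nat_le_iff of_nat_mult of_nat_power)
      also have "\<dots> \<le> (K ^ m) ^ q * B"
        using bm by (intro mult_right_mono power_mono) auto
      also have "(K ^ m) ^ q = K ^ (q * m)"
        by (simp add: power_mult[symmetric] mult.commute)
      also have "K ^ (q * m) * B \<le> K ^ n * B"
        using K1 nqr by (intro mult_right_mono power_increasing) auto
      finally show ?thesis .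
    qed
    have "(\<lambda>n. K * root n B) \<longlonglongrightarrow> K * 1"
      using LIMSEQ_root_const[of B] B1 by (intro tendsto_intros) auto
    then have "\<forall>\<^sub>F n in sequentially. K * root n B < L + e"
      by (rule order_tendstoD) (use e in \<open>simp add: K_def\<close>)
    then obtain N where N: "\<And>n. n \<ge> N \<Longrightarrow> K * root n B < L + e"
      unfolding eventually_sequentially by auto
    show "\<exists>no. \<forall>n\<ge>no. norm (f n - L) < e"
    proof (intro exI allI impI)
      fix n assume n: "n \<ge> max N m"
      then have n1: "n \<ge> 1" using m by simp
      have "f n \<le> root n (K ^ n * B)"
        unfolding f_def using main[of n] n n1 by simp
      also have "\<dots> = K * root n B"
        using n1 K1 by (simp add: real_root_mult real_root_power_cancel)
      also have "\<dots> < L + e" using N n by simp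
      finally show "norm (f n - L) < e" using L_le[OF n1] by simp
    qed
  qed
  then show ?thesis unfolding f_def by blast
qed

section \<open>Words, balls and growth in a finitely generated group\<close>

context group
begin

lemma word_value_closed: "set w \<subseteq> carrier G \<Longrightarrow> word_value G w \<in> carrier G"
  by (induction w) (auto simp: word_value_def)

lemma word_value_append:
  "\<lbrakk>set v \<subseteq> carrier G; set w \<subseteq> carrier G\<rbrakk> \<Longrightarrow>
    word_value G (v @ w) = word_value G v \<otimes> word_value G w"
  by (induction v) (auto simp: word_value_def m_assoc word_value_closed[unfolded word_value_def])

text \<open>Symmetry of \<open>S\<close> turns the inverse clause of \<open>generate\<close> into a
  one-letter word.\<close>

lemma generate_obtains_word:
  assumes "S \<subseteq> carrier G" and sym: "\<And>s. s \<in> S \<Longrightarrow> inv s \<in> S" and "g \<in> generate G S"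
  obtains w where "set w \<subseteq> S" and "word_value G w = g"
  using \<open>g \<in> generate G S\<close>
proof (induction arbitrary: thesis rule: generate.induct)
  case one
  show ?case by (rule one[of "[]"]) (auto simp: word_value_def)
next
  case (incl h)
  show ?case by (rule incl(2)[of "[h]"]) (use incl assms in \<open>auto simp: word_value_def\<close>)
next
  case (inv h)
  show ?case by (rule inv(2)[of "[inv h]"]) (use inv assms in \<open>auto simp: word_value_def\<close>)
next
  case (eng g h)
  obtain v w where "set v \<subseteq> S" "word_value G v = g" "set w \<subseteq> S" "word_value G w = h"
    using eng.IH by metis
  then show ?case
    using assms(1) by (intro eng.prems[of "v @ w"]) (auto simp: word_value_append)
qed

text \<open>Since \<open>S\<close> generates, the \<open>LEAST\<close> in \<open>word_length\<close>
  ranges over a nonempty set and is attained by an actual word.\<close>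

lemma word_length_le_iff:
  assumes "finite_symmetric_generating_set G S" "g \<in> carrier G"
  shows "word_length G S g \<le> k \<longleftrightarrow> (\<exists>w. set w \<subseteq> S \<and> length w \<le> k \<and> word_value G w = g)"
proof
  obtain w where "set w \<subseteq> S" "word_value G w = g"
    using assms generate_obtains_word[of S g] unfolding finite_symmetric_generating_set_def by metis
  then have "\<exists>n w. set w \<subseteq> S \<and> length w = n \<and> word_value G w = g" by blast
  then have "\<exists>w. set w \<subseteq> S \<and> length w = word_length G S g \<and> word_value G w = g"
    unfolding word_length_def by (rule LeastI_ex)
  then show "\<exists>w. set w \<subseteq> S \<and> length w \<le> k \<and> word_value G w = g" if "word_length G S g \<le> k"
    using that by metis
next
  assume "\<exists>w. set w \<subseteq> S \<and> length w \<le> k \<and> word_value G w = g"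
  then obtain w where w: "set w \<subseteq> S" "length w \<le> k" "word_value G w = g" by blast
  have "word_length G S g \<le> length w"
    unfolding word_length_def by (rule Least_le) (use w in blast)
  with w show "word_length G S g \<le> k" by simp
qed

lemma word_length_ball:
  assumes S: "finite_symmetric_generating_set G S"
  shows "{g \<in> carrier G. word_length G S g \<le> k} = word_value G ` {w. set w \<subseteq> S \<and> length w \<le> k}"
  using S word_length_le_iff[OF S] word_value_closed
  unfolding finite_symmetric_generating_set_def by (auto simp: image_iff) blast+

lemma finite_word_length_ball:
  assumes "finite_symmetric_generating_set G S"
  shows "finite {g \<in> carrier G. word_length G S g \<le> k}"
  unfolding word_length_ball[OF assms] using assms
  by (intro finite_imageI finite_lists_length_le) (auto simp: finite_symmetric_generating_set_def)

lemma word_length_mult: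
  assumes S: "finite_symmetric_generating_set G S" and gh: "g \<in> carrier G" "h \<in> carrier G"
  shows "word_length G S (g \<otimes> h) \<le> word_length G S g + word_length G S h"
proof -
  obtain v w where "set v \<subseteq> S" "length v \<le> word_length G S g" "word_value G v = g"
    "set w \<subseteq> S" "length w \<le> word_length G S h" "word_value G w = h"
    using word_length_le_iff[OF S gh(1)] word_length_le_iff[OF S gh(2)] by (meson le_refl)
  then show ?thesis
    using S gh by (subst word_length_le_iff)
      (auto simp: word_value_append finite_symmetric_generating_set_def intro!: exI[of _ "v @ w"])
qed

text \<open>Cutting a word of length at most \<open>m + n\<close> after \<open>m\<close> letters
  writes its value as a product from the two smaller balls.\<close>

lemma growth_function_submultiplicative:
  assumes S: "finite_symmetric_generating_set G S"
  shows "growth_function G S (m + n) \<le> growth_function G S m * growth_function G S n"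
proof -
  let ?B = "\<lambda>k. {g \<in> carrier G. word_length G S g \<le> k}"
  have SG: "S \<subseteq> carrier G" using S by (simp add: finite_symmetric_generating_set_def)
  have "?B (m + n) \<subseteq> (\<lambda>(g, h). g \<otimes> h) ` (?B m \<times> ?B n)"
  proof
    fix g assume "g \<in> ?B (m + n)"
    then obtain w where w: "set w \<subseteq> S" "length w \<le> m + n" "word_value G w = g"
      unfolding word_length_ball[OF S] by auto
    have sub: "set (take m w) \<subseteq> S" "set (drop m w) \<subseteq> S"
      using w(1) set_take_subset set_drop_subset by fast+
    have "g = word_value G (take m w) \<otimes> word_value G (drop m w)"
      using w sub SG by (subst word_value_append[symmetric]) auto
    moreover have "word_value G (take m w) \<in> ?B m" "word_value G (drop m w) \<in> ?B n"
      unfolding word_length_ball[OF S] using w sub by auto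
    ultimately show "g \<in> (\<lambda>(g, h). g \<otimes> h) ` (?B m \<times> ?B n)"
      by (auto simp: image_iff)
  qed
  then have "card (?B (m + n)) \<le> card (?B m \<times> ?B n)"
    using finite_word_length_ball[OF S]
    by (intro surj_card_le) auto
  then show ?thesis by (simp add: growth_function_def card_cartesian_product)
qed

lemma finitely_generated_symmetric:
  assumes "finitely_generated_group G"
  shows "\<exists>S. finite_symmetric_generating_set G S"
proof -
  obtain S where S: "finite S" "S \<subseteq> carrier G" "generate G S = carrier G"
    using assms by (auto simp: finitely_generated_group_def)
  define S' where "S' = S \<union> m_inv G ` S"
  have S': "S' \<subseteq> carrier G" "finite S'" and sym: "\<forall>s\<in>S'. inv s \<in> S'"
    using S(1,2) by (auto simp: S'_def subset_iff)
  have "generate G S' = carrier G"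
  proof
    show "generate G S' \<subseteq> carrier G" using S'(1) by (rule generate_incl)
    show "carrier G \<subseteq> generate G S'"
      using mono_generate[of S S'] S(3) by (simp add: S'_def)
  qed
  then have "finite_symmetric_generating_set G S'"
    unfolding finite_symmetric_generating_set_def using S' sym by blast
  then show ?thesis ..
qed

text \<open>When the word acts on points, \<open>s\<close> runs \<open>n\<close> times and, for each
  \<open>k < n\<close> in \<open>A\<close>, \<open>t\<close> is inserted after exactly
  \<open>k\<close> runs of \<open>s\<close>.\<close>

fun subset_word :: "'a \<Rightarrow> 'a \<Rightarrow> nat set \<Rightarrow> nat \<Rightarrow> 'a" where
  "subset_word s t A 0 = \<one>"
| "subset_word s t A (Suc n) = s \<otimes> ((if n \<in> A then t else \<one>) \<otimes> subset_word s t A n)"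

lemma subset_word_closed [simp]:
  "\<lbrakk>s \<in> carrier G; t \<in> carrier G\<rbrakk> \<Longrightarrow> subset_word s t A n \<in> carrier G"
  by (induction n) auto

text \<open>A word of \<open>n\<close> blocks has length at most \<open>n * K\<close>, so the ball
  of that radius has at least \<open>2 ^ n\<close> elements. The limit exists by
  submultiplicativity, hence a lower bound along the radii \<open>Suc n * K\<close> is
  enough.\<close>

lemma exponential_growth_if_inj_subset_word:
  assumes fg: "finitely_generated_group G" and st: "s \<in> carrier G" "t \<in> carrier G"
    and inj: "\<And>n. inj_on (\<lambda>A. subset_word s t A n) (Pow {..<n})"
  shows "exponential_growth G"
proof -
  obtain S where S: "finite_symmetric_generating_set G S"
    using finitely_generated_symmetric[OF fg] ..
  let ?len = "word_length G S" and ?b = "growth_function G S"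
  \<comment> \<open>The added 1 keeps \<open>K\<close> positive, so that the radii increase strictly
    and \<open>root K 2\<close> makes sense and exceeds 1.\<close>
  define K where "K = ?len s + ?len t + 1"
  have len1: "?len \<one> = 0"
    using word_length_le_iff[OF S, of \<one> 0] by (simp add: word_value_def)
  have len: "?len (subset_word s t A n) \<le> n * K" for A n
  proof (induction n)
    case (Suc n)
    have "?len (subset_word s t A (Suc n)) \<le>
        ?len s + (?len (if n \<in> A then t else \<one>) + ?len (subset_word s t A n))"
      using word_length_mult[OF S] st
      by (smt (verit, best) add_left_mono le_trans m_closed one_closed subset_word.simps(2) subset_word_closed)
    then show ?case using Suc len1 by (simp add: K_def split: if_splits)
  qed (simp add: len1)
  have low: "2 ^ n \<le> ?b (n * K)" for n
  proof -
    have "card ((\<lambda>A. subset_word s t A n) ` Pow {..<n}) = 2 ^ n"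
      using card_image[OF inj] by (simp add: card_Pow)
    moreover have "card ((\<lambda>A. subset_word s t A n) ` Pow {..<n}) \<le> ?b (n * K)"
      unfolding growth_function_def using len st finite_word_length_ball[OF S]
      by (intro card_mono) auto
    ultimately show ?thesis by simp
  qed
  have pos: "?b k \<ge> 1" for k
    unfolding growth_function_def using finite_word_length_ball[OF S, of k] len1
    by (simp add: Suc_le_eq card_gt_0_iff) force
  obtain L where L: "(\<lambda>k. root k (real (?b k))) \<longlonglongrightarrow> L"
    using submultiplicative_root_convergent[of ?b] pos growth_function_submultiplicative[OF S] by blast
  have "strict_mono (\<lambda>n::nat. Suc n * K)"
    by (intro strict_monoI mult_strict_right_mono) (auto simp: K_def)
  then have lim: "(\<lambda>n. root (Suc n * K) (real (?b (Suc n * K)))) \<longlonglongrightarrow> L"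
    using LIMSEQ_subseq_LIMSEQ[OF L] by (simp add: o_def)
  have "root K 2 \<le> L"
  proof (rule LIMSEQ_le_const[OF lim], intro exI allI impI)
    fix n :: nat
    have "root K 2 = root K (root (Suc n) (2 ^ Suc n))"
      by (subst real_root_power_cancel) auto
    also have "\<dots> = root (Suc n * K) (2 ^ Suc n)"
      by (metis mult.commute real_root_mult_exp)
    also have "\<dots> \<le> root (Suc n * K) (real (?b (Suc n * K)))"
    proof -
      have "(2::real) ^ Suc n \<le> real (?b (Suc n * K))"
        using low[of "Suc n"] by (metis of_nat_le_iff of_nat_numeral of_nat_power)
      then show ?thesis by (simp add: K_def)
    qed
    finally show "root K 2 \<le> root (Suc n * K) (real (?b (Suc n * K)))" .
  qed
  moreover have "root K 2 > 1" by (simp add: K_def)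
  ultimately show ?thesis
    unfolding exponential_growth_def using S L by (intro exI[of _ S] conjI exI[of _ L]) auto
qed

end

text \<open>Over the field with two elements, a nonempty symmetric difference of \<open>A\<close>
  and \<open>B\<close> would give one linear recurrence satisfied by the visits to \<open>U\<close>
  along every \<open>T\<close>-orbit in \<open>C\<close>. A recurrence on finitely many states is
  eventually periodic with uniform constants, and surjectivity of \<open>T\<close> removes the
  preperiod.\<close>

lemma subset_eq_if_visit_parity_eq:
  fixes T :: "'a \<Rightarrow> 'a"
  assumes surj: "T ` C = C"
    and nonper: "\<And>p. p \<ge> 1 \<Longrightarrow> \<exists>y\<in>C. (y \<in> U) \<noteq> ((T ^^ p) y \<in> U)"
    and AB: "A \<subseteq> {..<n}" "B \<subseteq> {..<n}"
    and eq: "\<And>y. y \<in> C \<Longrightarrow>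
      odd (card {k\<in>A. (T ^^ k) y \<in> U}) = odd (card {k\<in>B. (T ^^ k) y \<in> U})"
  shows "A = B"
proof (rule ccontr)
  assume "A \<noteq> B"
  define E where "E = (A - B) \<union> (B - A)"
  have fin: "finite A" "finite B" "finite E"
    using AB by (auto simp: E_def intro: finite_subset)
  have "E \<noteq> {}" using \<open>A \<noteq> B\<close> by (auto simp: E_def)
  define d where "d = Max E"
  have dE: "d \<in> E" and E: "E \<subseteq> {..d}"
    using fin \<open>E \<noteq> {}\<close> by (auto simp: d_def)
  have even: "even (card {k\<in>E. (T ^^ k) y \<in> U})" if "y \<in> C" for y
  proof -
    let ?A = "{k\<in>A. (T ^^ k) y \<in> U}" and ?B = "{k\<in>B. (T ^^ k) y \<in> U}"
    have "{k\<in>E. (T ^^ k) y \<in> U} = (?A - ?B) \<union> (?B - ?A)" by (auto simp: E_def)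
    then have "card {k\<in>E. (T ^^ k) y \<in> U} = card (?A - ?B) + card (?B - ?A)"
      using fin by (simp add: card_Un_disjoint disjoint_iff)
    moreover have "card ?A = card (?A \<inter> ?B) + card (?A - ?B)"
      "card ?B = card (?A \<inter> ?B) + card (?B - ?A)"
      using fin by (subst card_Un_disjoint[symmetric]; auto intro!: arg_cong[where f = card])+
    ultimately show ?thesis using eq[OF that] by presburger
  qed
  \<comment> \<open>The relation \<open>E\<close> makes the length-\<open>d\<close> code \<open>v y\<close> determine \<open>v (T y)\<close> by a map \<open>\<Psi>\<close> on a
    finite set, so two iterates of \<open>\<Psi>\<close> coincide there.\<close>
  define v where "v y = {k. k < d \<and> (T ^^ k) y \<in> U}" for y
  define \<Psi> where "\<Psi> V = {k. k < d \<and> (if Suc k < d then Suc k \<in> V else odd (card (V \<inter> E)))}" for V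
  have step: "(T ^^ d) y \<in> U \<longleftrightarrow> odd (card (v y \<inter> E))" if "y \<in> C" for y
  proof -
    have "{k\<in>E. (T ^^ k) y \<in> U} = (v y \<inter> E) \<union> (if (T ^^ d) y \<in> U then {d} else {})"
      using dE E by (auto simp: v_def less_le)
    moreover have "d \<notin> v y" by (simp add: v_def)
    ultimately show ?thesis
      using even[OF that] fin by (auto split: if_splits)
  qed
  have TC: "(T ^^ i) y \<in> C" if "y \<in> C" for i y
    using that surj by (induction i) auto
  have v_step: "v (T y) = \<Psi> (v y)" if "y \<in> C" for y
  proof -
    have "(T ^^ k) (T y) \<in> U \<longleftrightarrow> (if Suc k < d then Suc k \<in> v y else odd (card (v y \<inter> E)))"
      if "k < d" for k
    proof (cases "Suc k < d")
      case True
      then show ?thesis by (simp add: v_def funpow_swap1)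
    next
      case False
      then have "Suc k = d" using that by simp
      then show ?thesis using step[OF \<open>y \<in> C\<close>] by (auto simp: funpow_swap1)
    qed
    then show ?thesis unfolding \<Psi>_def v_def[of "T y"] by blast
  qed
  have v_iter: "v ((T ^^ i) y) = (\<Psi> ^^ i) (v y)" if "y \<in> C" for i y
    using that by (induction i) (auto simp: v_step TC)
  have v_Pow: "v y \<in> Pow {..<d}" for y by (auto simp: v_def)
  \<comment> \<open>Restricting to the finite set of codes puts all iterates into one finite
    function space, where the pigeonhole principle applies.\<close>
  define R where "R i = restrict (\<Psi> ^^ i) (Pow {..<d})" for i
  have \<Psi>_Pow: "(\<Psi> ^^ i) V \<in> Pow {..<d}" if "V \<in> Pow {..<d}" for i V
    using that by (induction i) (auto simp: \<Psi>_def)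
  have "R i \<in> Pow {..<d} \<rightarrow>\<^sub>E Pow {..<d}" for i
    unfolding R_def by (intro restrict_PiE_iff[THEN iffD2] ballI \<Psi>_Pow)
  then have "finite (range R)"
    by (intro finite_subset[of "range R" "Pow {..<d} \<rightarrow>\<^sub>E Pow {..<d}"] image_subsetI finite_PiE) simp_all
  then have "\<not> inj R"
    using finite_imageD by fastforce
  then obtain i j where ij: "i < j" "R i = R j"
    by (metis injI linorder_neqE_nat)
  have vij: "v ((T ^^ i) y) = v ((T ^^ j) y)" if "y \<in> C" for y
    using fun_cong[OF ij(2), of "v y"] v_Pow[of y] v_iter[OF that] by (simp add: R_def)
  have surj_i: "(T ^^ i) ` C = C"
  proof (induction i)
    case (Suc i)
    have "(T ^^ Suc i) ` C = T ` (T ^^ i) ` C" by (simp add: image_image)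
    then show ?case using Suc surj by simp
  qed simp
  \<comment> \<open>Every point of \<open>C\<close> has the form \<open>(T ^^ i) y\<close>, so the
    common first \<open>i\<close> steps can be cancelled.\<close>
  have period: "v z = v ((T ^^ (j - i)) z)" if "z \<in> C" for z
  proof -
    have "z \<in> (T ^^ i) ` C" using that surj_i by simp
    then obtain y where y: "y \<in> C" "z = (T ^^ i) y" by (elim imageE)
    have "(T ^^ (j - i + i)) y = (T ^^ (j - i)) ((T ^^ i) y)"
      unfolding funpow_add by (rule o_apply)
    then have "(T ^^ j) y = (T ^^ (j - i)) z" using ij(1) y by simp
    then show ?thesis using vij[OF y(1)] y by simp
  qed
  have per: "(y \<in> U) = ((T ^^ (j - i)) y \<in> U)" if "y \<in> C" for y
  \<comment> \<open>For \<open>d = 0\<close> the codes are empty and carry no information, but then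
    \<open>step\<close> says that \<open>U\<close> misses \<open>C\<close> altogether.\<close>
  proof (cases "d = 0")
    case True
    then have "v y = {}" "v ((T ^^ (j - i)) y) = {}" by (auto simp: v_def)
    then show ?thesis using step[OF that] step[OF TC[OF that], of "j - i"] True by simp
  next
    case False
    have "0 \<in> v y \<longleftrightarrow> 0 \<in> v ((T ^^ (j - i)) y)" by (rule arg_cong[OF period[OF that]])
    then show ?thesis using False by (simp add: v_def)
  qed
  have "1 \<le> j - i" using ij(1) by simp
  then obtain y where "y \<in> C" "(y \<in> U) \<noteq> ((T ^^ (j - i)) y \<in> U)" using nonper by blast
  then show False using per by blast
qed

section \<open>The topological full group as a group of homeomorphisms\<close>

text \<open>The inverse in \<open>BijGroup\<close> is this restricted \<open>inv_into\<close>; on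
  the space it agrees with the inverse homeomorphism.\<close>

lemma homeomorphic_map_inv_into:
  assumes "homeomorphic_map X X f"
  shows "homeomorphic_map X X (restrict (inv_into (topspace X) f) (topspace X))"
proof -
  obtain g where g: "homeomorphic_maps X X f g"
    using assms homeomorphic_map_maps by blast
  have inj: "inj_on f (topspace X)" and im: "f ` topspace X = topspace X"
    using assms by (auto simp: homeomorphic_eq_everything_map)
  have "restrict (inv_into (topspace X) f) (topspace X) x = g x" if "x \<in> topspace X" for x
    using g that inj by (auto simp: homeomorphic_maps_def continuous_map_def Pi_iff intro!: inv_into_f_eq)
  moreover have "homeomorphic_map X X g"
    using g homeomorphic_maps_map by blast
  ultimately show ?thesis
    using homeomorphic_map_eq[of X X g] by metis
qed

lemma mult_BijGroup_apply:
  "\<lbrakk>f \<in> Bij S; g \<in> Bij S; x \<in> S\<rbrakk> \<Longrightarrow> (f \<otimes>\<^bsub>BijGroup S\<^esub> g) x = f (g x)"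
  by (simp add: BijGroup_def compose_def)

lemma subgroup_homeo: "subgroup {f \<in> Bij (topspace X). homeomorphic_map X X f} (BijGroup (topspace X))"
proof (rule group.subgroupI[OF group_BijGroup])
  have "homeomorphic_map X X (\<lambda>x\<in>topspace X. x)"
    using homeomorphic_map_eq[of X X id "\<lambda>x\<in>topspace X. x"] by simp
  then show "{f \<in> Bij (topspace X). homeomorphic_map X X f} \<noteq> {}"
    using id_Bij by blast
  show "inv\<^bsub>BijGroup (topspace X)\<^esub> f \<in> {f \<in> Bij (topspace X). homeomorphic_map X X f}"
    if "f \<in> {f \<in> Bij (topspace X). homeomorphic_map X X f}" for f
    using that homeomorphic_map_inv_into[of X f] by (simp add: inv_BijGroup restrict_inv_into_Bij)
  show "f \<otimes>\<^bsub>BijGroup (topspace X)\<^esub> g \<in> {f \<in> Bij (topspace X). homeomorphic_map X X f}"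
    if "f \<in> {f \<in> Bij (topspace X). homeomorphic_map X X f}"
      "g \<in> {f \<in> Bij (topspace X). homeomorphic_map X X f}" for f g
  proof -
    have "homeomorphic_map X X (compose (topspace X) f g)"
      using homeomorphic_map_eq[of X X "f \<circ> g" "compose (topspace X) f g"] that
        homeomorphic_map_compose[of X X g X f] by (simp add: compose_def)
    then show ?thesis using that by (simp add: BijGroup_def compose_Bij)
  qed
qed (auto simp: BijGroup_def)

lemma group_homeo_group: "group (homeo_group X)"
  unfolding homeo_group_def by (rule subgroup.subgroup_is_group[OF subgroup_homeo group_BijGroup])

lemma carrier_homeo_group:
  "f \<in> carrier (homeo_group X) \<longleftrightarrow> f \<in> Bij (topspace X) \<and> homeomorphic_map X X f"
  by (simp add: homeo_group_def)

lemma mult_homeo_group_apply: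
  "\<lbrakk>f \<in> carrier (homeo_group X); g \<in> carrier (homeo_group X); x \<in> topspace X\<rbrakk>
    \<Longrightarrow> (f \<otimes>\<^bsub>homeo_group X\<^esub> g) x = f (g x)"
  by (simp add: homeo_group_def mult_BijGroup_apply)

lemma one_homeo_group_apply [simp]: "x \<in> topspace X \<Longrightarrow> \<one>\<^bsub>homeo_group X\<^esub> x = x"
  by (simp add: homeo_group_def BijGroup_def)

lemma homeo_group_apply_in: "\<lbrakk>f \<in> carrier (homeo_group X); x \<in> topspace X\<rbrakk> \<Longrightarrow> f x \<in> topspace X"
  using Bij_imp_funcset by (auto simp: carrier_homeo_group)

section \<open>Clopen sets and maps to discrete spaces\<close>

lemma continuous_map_discrete_iff:
  "continuous_map X (discrete_topology UNIV) c \<longleftrightarrow> (\<forall>n. openin X {x \<in> topspace X. c x = n})"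
proof
  assume "continuous_map X (discrete_topology UNIV) c"
  then show "\<forall>n. openin X {x \<in> topspace X. c x = n}"
    using openin_continuous_map_preimage[of X "discrete_topology UNIV" c "{_}"] by auto
next
  assume *: "\<forall>n. openin X {x \<in> topspace X. c x = n}"
  have "openin X {x \<in> topspace X. c x \<in> U}" for U
  proof -
    have "{x \<in> topspace X. c x \<in> U} = \<Union>((\<lambda>n. {x \<in> topspace X. c x = n}) ` U)" by auto
    then show ?thesis using * by (metis (mono_tags, lifting) image_iff openin_Union)
  qed
  then show "continuous_map X (discrete_topology UNIV) c"
    by (simp add: continuous_map_def)
qed

definition clopenin :: "'a topology \<Rightarrow> 'a set \<Rightarrow> bool" where
  "clopenin X S \<longleftrightarrow> closedin X S \<and> openin X S"

lemma clopenin_subset: "clopenin X S \<Longrightarrow> S \<subseteq> topspace X"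
  by (simp add: clopenin_def closedin_subset)

lemma clopenin_Int: "\<lbrakk>clopenin X S; clopenin X T\<rbrakk> \<Longrightarrow> clopenin X (S \<inter> T)"
  by (auto simp: clopenin_def)

lemma clopenin_Diff: "\<lbrakk>clopenin X S; clopenin X T\<rbrakk> \<Longrightarrow> clopenin X (S - T)"
  by (auto simp: clopenin_def)

lemma clopenin_topspace: "clopenin X (topspace X)"
  by (auto simp: clopenin_def)

lemma clopenin_preimage_discrete:
  assumes "continuous_map X (discrete_topology UNIV) c"
  shows "clopenin X {x \<in> topspace X. c x \<in> U}"
  unfolding clopenin_def
  using openin_continuous_map_preimage[OF assms, of U] closedin_continuous_map_preimage[OF assms, of U]
  by auto

lemma continuous_map_discrete_If:
  assumes S: "clopenin X S" and c: "continuous_map X (discrete_topology UNIV) c"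
    "continuous_map X (discrete_topology UNIV) d"
  shows "continuous_map X (discrete_topology UNIV) (\<lambda>x. if x \<in> S then c x else d x)"
  unfolding continuous_map_discrete_iff
proof
  fix n
  have "{x \<in> topspace X. (if x \<in> S then c x else d x) = n} =
    (S \<inter> {x \<in> topspace X. c x \<in> {n}}) \<union> ({x \<in> topspace X. d x \<in> {n}} - S)"
    using clopenin_subset[OF S] by auto
  then show "openin X {x \<in> topspace X. (if x \<in> S then c x else d x) = n}"
    using S c[THEN clopenin_preimage_discrete, of "{n}"]
    by (auto simp: clopenin_def intro!: openin_Un openin_Int openin_diff)
qed

lemma compact_space_discrete_image_finite:
  assumes "compact_space X" "continuous_map X (discrete_topology UNIV) c"
  shows "finite (c ` topspace X)"
  using image_compactin[of X "topspace X" "discrete_topology UNIV" c] assms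
  by (simp add: compact_space_def compactin_discrete_topology)

text \<open>In a compact Hausdorff space quasi-components are components, and here components are
  single points.\<close>

lemma clopenin_separates:
  assumes "compact_space X" "Hausdorff_space X" "totally_disconnected_space X"
    and "x \<in> topspace X" "y \<in> topspace X" "x \<noteq> y"
  obtains W where "clopenin X W" "x \<in> W" "y \<notin> W"
proof -
  have "\<not> quasi_component_of X x y"
  proof
    assume "quasi_component_of X x y"
    then have "connected_component_of X x y"
      using quasi_eq_connected_component_of[of X x] assms by auto
    then obtain T where "connectedin X T" "x \<in> T" "y \<in> T"
      by (auto simp: connected_component_of_def)
    then show False
      using assms by (auto simp: totally_disconnected_space_def)
  qed
  then obtain T where T: "clopenin X T" "(x \<in> T) \<noteq> (y \<in> T)"
    using assms by (auto simp: quasi_component_of_def clopenin_def)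
  show ?thesis
  proof (cases "x \<in> T")
    case True
    then show ?thesis using that[of T] T by auto
  next
    case False
    then show ?thesis
      using that[of "topspace X - T"] T assms clopenin_Diff[OF clopenin_topspace] by auto
  qed
qed

section \<open>Orbits of a Cantor minimal system\<close>

locale cantor_minimal =
  fixes X :: "'a topology" and \<phi> :: "'a \<Rightarrow> 'a"
  assumes minimal_system: "Cantor_minimal_system X \<phi>"
begin

abbreviation iterate :: "int \<Rightarrow> 'a \<Rightarrow> 'a" where
  "iterate n \<equiv> \<phi> [^]\<^bsub>homeo_group X\<^esub> n"

abbreviation \<G> :: "('a \<Rightarrow> 'a) monoid" where
  "\<G> \<equiv> topological_full_group X \<phi>"

abbreviation commutator :: "('a \<Rightarrow> 'a) \<Rightarrow> ('a \<Rightarrow> 'a) \<Rightarrow> 'a \<Rightarrow> 'a" where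
  "commutator f g \<equiv> f \<otimes>\<^bsub>\<G>\<^esub> g \<otimes>\<^bsub>\<G>\<^esub> inv\<^bsub>\<G>\<^esub> f \<otimes>\<^bsub>\<G>\<^esub> inv\<^bsub>\<G>\<^esub> g"

sublocale homeo: group "homeo_group X"
  by (rule group_homeo_group)

lemma Cantor: "Cantor_set X"
  and \<phi>_in: "\<phi> \<in> carrier (homeo_group X)"
  and dense: "x \<in> topspace X \<Longrightarrow> X closure_of homeo_orbit X \<phi> x = topspace X"
  using minimal_system by (auto simp: Cantor_minimal_system_def)

lemma nonempty: "topspace X \<noteq> {}" and compact: "compact_space X" and Hausdorff: "Hausdorff_space X"
  and tot_disc: "totally_disconnected_space X"
  and no_isolated: "x \<in> topspace X \<Longrightarrow> \<not> openin X {x}"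
  using Cantor by (auto simp: Cantor_set_def metrizable_imp_Hausdorff_space)

lemma iterate_carrier: "iterate n \<in> carrier (homeo_group X)"
  using \<phi>_in by (rule homeo.int_pow_closed)

lemma iterate_in [simp]: "x \<in> topspace X \<Longrightarrow> iterate n x \<in> topspace X"
  using homeo_group_apply_in iterate_carrier by metis

lemma iterate_0 [simp]: "x \<in> topspace X \<Longrightarrow> iterate 0 x = x"
  by (simp add: one_homeo_group_apply)

lemma iterate_iterate [simp]: "x \<in> topspace X \<Longrightarrow> iterate m (iterate n x) = iterate (m + n) x"
  using homeo.int_pow_mult[OF \<phi>_in, of m n] mult_homeo_group_apply[OF iterate_carrier iterate_carrier]
  by metis

lemma iterate_inject [simp]:
  "\<lbrakk>x \<in> topspace X; y \<in> topspace X\<rbrakk> \<Longrightarrow> iterate n x = iterate n y \<longleftrightarrow> x = y"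
  by (metis add.left_inverse iterate_0 iterate_iterate)

lemma continuous_iterate: "continuous_map X X (iterate n)"
  using iterate_carrier carrier_homeo_group homeomorphic_imp_continuous_map by blast

lemma clopenin_iterate_preimage:
  "clopenin X S \<Longrightarrow> clopenin X {x \<in> topspace X. iterate n x \<in> S}"
  unfolding clopenin_def
  using openin_continuous_map_preimage[OF continuous_iterate] closedin_continuous_map_preimage[OF continuous_iterate]
  by blast

lemma orbit_meets_open:
  assumes "x \<in> topspace X" "openin X W" "W \<noteq> {}"
  obtains n where "iterate n x \<in> W"
proof -
  obtain w where "w \<in> W" using assms by auto
  then have "w \<in> X closure_of homeo_orbit X \<phi> x"
    using dense assms openin_subset by blast
  then obtain y where "y \<in> homeo_orbit X \<phi> x" "y \<in> W"
    using assms \<open>w \<in> W\<close> by (auto simp: in_closure_of)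
  then show ?thesis using that by (auto simp: homeo_orbit_def)
qed

text \<open>A periodic orbit is finite, hence closed, hence by density the whole space; but a finite
  Hausdorff space has isolated points.\<close>

lemma iterate_free:
  assumes x: "x \<in> topspace X" and eq: "iterate n x = x"
  shows "n = 0"
proof (rule ccontr)
  assume "n \<noteq> 0"
  have mult: "iterate (n * k) x = x" for k
  proof (induction k rule: int_induct[of _ 0])
    case (step1 i)
    then show ?case using eq x iterate_iterate[OF x, of "n * i" n] by (simp add: algebra_simps)
  next
    case (step2 i)
    have "iterate n (iterate (n * (i - 1)) x) = iterate n x"
      using step2 eq x by (simp add: algebra_simps)
    then show ?case using x by (subst (asm) iterate_inject) auto
  qed (use x in simp)
  \<comment> \<open>This symmetric interval contains every residue \<open>k mod n\<close>, whatever
    the sign of \<open>n\<close>.\<close>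
  have "homeo_orbit X \<phi> x \<subseteq> (\<lambda>k. iterate k x) ` {- \<bar>n\<bar>..\<bar>n\<bar>}"
  proof
    fix y assume "y \<in> homeo_orbit X \<phi> x"
    then obtain k where k: "y = iterate k x" by (auto simp: homeo_orbit_def)
    have "y = iterate (k mod n) (iterate (n * (k div n)) x)"
      using x k by simp
    then have "y = iterate (k mod n) x" using mult by simp
    moreover have "k mod n \<in> {- \<bar>n\<bar>..\<bar>n\<bar>}"
      using abs_mod_less[OF \<open>n \<noteq> 0\<close>, of k] by auto
    ultimately show "y \<in> (\<lambda>k. iterate k x) ` {- \<bar>n\<bar>..\<bar>n\<bar>}" by blast
  qed
  then have fin: "finite (homeo_orbit X \<phi> x)"
    by (rule finite_subset) auto
  have "homeo_orbit X \<phi> x \<subseteq> topspace X"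
    using x by (auto simp: homeo_orbit_def)
  then have "closedin X (homeo_orbit X \<phi> x)"
    using closedin_Hausdorff_finite[OF Hausdorff _ fin] by blast
  then have "topspace X = homeo_orbit X \<phi> x"
    using dense[OF x] by (simp add: closure_of_closedin)
  then have "closedin X (topspace X - {x})"
    using closedin_Hausdorff_finite[OF Hausdorff, of "topspace X - {x}"] fin by auto
  then have "openin X (topspace X - (topspace X - {x}))"
    by blast
  moreover have "topspace X - (topspace X - {x}) = {x}" using x by auto
  ultimately show False using no_isolated[OF x] by simp
qed

lemma iterate_eq_iff [simp]: "x \<in> topspace X \<Longrightarrow> iterate m x = iterate n x \<longleftrightarrow> m = n"
proof
  assume x: "x \<in> topspace X" and "iterate m x = iterate n x"
  then have "iterate (- n) (iterate m x) = iterate (- n) (iterate n x)" by simp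
  then show "m = n" using iterate_free[OF x, of "m - n"] x by simp
qed simp

text \<open>Compactness makes the hitting times of an open set bounded, so that two-sided density of
  orbits can be upgraded to one-sided recurrence.\<close>

lemma bounded_hitting_time:
  assumes W: "openin X W" "W \<noteq> {}"
  obtains N :: nat where "\<And>x. x \<in> topspace X \<Longrightarrow> \<exists>n. 1 \<le> n \<and> n \<le> N \<and> iterate (int n) x \<in> W"
proof -
  let ?U = "\<lambda>n. {x \<in> topspace X. iterate n x \<in> W}"
  have "\<exists>\<F>. finite \<F> \<and> \<F> \<subseteq> range ?U \<and> topspace X \<subseteq> \<Union>\<F>"
  proof (rule compactinD)
    show "compactin X (topspace X)" using compact by (simp add: compact_space_def)
    show "openin X U" if "U \<in> range ?U" for U
      using that W openin_continuous_map_preimage[OF continuous_iterate] by auto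
    show "topspace X \<subseteq> \<Union>(range ?U)"
    proof
      fix x assume x: "x \<in> topspace X"
      then obtain n where "iterate n x \<in> W" using orbit_meets_open[OF x W] by blast
      then have "x \<in> ?U n" using x by simp
      then show "x \<in> \<Union>(range ?U)" by blast
    qed
  qed
  then obtain \<F> where \<F>: "finite \<F>" "\<F> \<subseteq> range ?U" "topspace X \<subseteq> \<Union>\<F>" by blast
  obtain I where "finite I" "\<F> = ?U ` I"
    using finite_subset_image[OF \<F>(1,2)] by blast
  then have I: "finite I" "topspace X \<subseteq> (\<Union>n\<in>I. ?U n)"
    using \<F>(3) by simp_all
  define M where "M = Max (insert 0 (abs ` I))"
  have M: "\<bar>n\<bar> \<le> M" if "n \<in> I" for n
    unfolding M_def using I that by (intro Max_ge) auto
  have M0: "M \<ge> 0" unfolding M_def using I by (intro Max_ge) auto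
  show ?thesis
  \<comment> \<open>Applying the finite cover at \<open>iterate (M + 1) x\<close> shifts hitting
    times from \<open>[-M, M]\<close> to \<open>[1, 2 * M + 1]\<close>, which makes them
    positive.\<close>
  proof (rule that[of "nat (2 * M + 1)"])
    fix x assume x: "x \<in> topspace X"
    then have "iterate (M + 1) x \<in> (\<Union>n\<in>I. ?U n)" using I by (meson iterate_in subsetD)
    then obtain n where "n \<in> I" "iterate (n + (M + 1)) x \<in> W" using x by auto
    then show "\<exists>n'. 1 \<le> n' \<and> n' \<le> nat (2 * M + 1) \<and> iterate (int n') x \<in> W"
      using M[of n] M0 by (intro exI[of _ "nat (n + (M + 1))"]) auto
  qed
qed

lemma forward_orbit_meets_clopen:
  assumes "clopenin X W" "z \<in> W" "x \<in> topspace X"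
  shows "\<exists>n. iterate (int n) x \<in> W"
proof (rule bounded_hitting_time)
  show "openin X W" "W \<noteq> {}" using assms by (auto simp: clopenin_def)
  fix N :: nat
  assume "\<And>x. x \<in> topspace X \<Longrightarrow> \<exists>n. 1 \<le> n \<and> n \<le> N \<and> iterate (int n) x \<in> W"
  from this[OF assms(3)] show ?thesis by (elim exE conjE) (rule exI)
qed

text \<open>By freeness, \<open>x\<close> differs from \<open>iterate j x\<close>. A clopen
  \<open>W\<close> containing only the first of them, cut down to the points that
  \<open>iterate j\<close> moves out of \<open>W\<close>, handles one \<open>j\<close>; intersecting
  handles finitely many.\<close>

lemma clopen_neighbourhood:
  assumes x: "x \<in> topspace X" and J: "finite J" "0 \<notin> J"
  obtains C where "clopenin X C" "x \<in> C" "\<And>j y. \<lbrakk>j \<in> J; y \<in> C\<rbrakk> \<Longrightarrow> iterate j y \<notin> C"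
proof -
  have "\<exists>C. clopenin X C \<and> x \<in> C \<and> (\<forall>j\<in>J. \<forall>y\<in>C. iterate j y \<notin> C)"
    using J
  proof (induction J)
    case empty
    then show ?case using x clopenin_topspace by blast
  next
    case (insert j J)
    then obtain C where C: "clopenin X C" "x \<in> C" "\<forall>j\<in>J. \<forall>y\<in>C. iterate j y \<notin> C" by auto
    have "x \<noteq> iterate j x" using iterate_free[OF x, of j] insert by auto
    then obtain W where W: "clopenin X W" "x \<in> W" "iterate j x \<notin> W"
      using clopenin_separates[OF compact Hausdorff tot_disc x iterate_in[OF x]] by metis
    let ?C = "C \<inter> (W - {y \<in> topspace X. iterate j y \<in> W})"
    have "clopenin X ?C"
      using C W clopenin_iterate_preimage by (intro clopenin_Int clopenin_Diff) auto
    moreover have "x \<in> ?C" using C W by auto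
    moreover have "iterate i y \<notin> ?C" if "i \<in> insert j J" "y \<in> ?C" for i y
      using that C W clopenin_subset[OF W(1)] by auto
    ultimately show ?case by blast
  qed
  then show ?thesis using that by blast
qed

text \<open>On each open level set of \<open>c\<close> the map is a fixed power of \<phi>, so it is
  continuous; a continuous bijection from a compact space to a Hausdorff space is a
  homeomorphism.\<close>

lemma continuous_cocycle_homeomorphic_map:
  assumes c: "continuous_map X (discrete_topology UNIV) (c :: 'a \<Rightarrow> int)"
    and h: "\<And>x. x \<in> topspace X \<Longrightarrow> h x = iterate (c x) x"
    and bij: "bij_betw h (topspace X) (topspace X)"
  shows "homeomorphic_map X X h"
proof (rule continuous_imp_homeomorphic_map)
  show "continuous_map X X h"
    unfolding continuous_map
  proof (intro conjI allI impI)
    show "h ` topspace X \<subseteq> topspace X" using h by auto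
    fix U assume U: "openin X U"
    have "{x \<in> topspace X. h x \<in> U} =
      (\<Union>n. {x \<in> topspace X. c x = n} \<inter> {x \<in> topspace X. iterate n x \<in> U})"
      using h by auto
    moreover have "openin X ({x \<in> topspace X. c x = n} \<inter> {x \<in> topspace X. iterate n x \<in> U})" for n
      using c U openin_continuous_map_preimage[OF continuous_iterate]
      by (intro openin_Int) (auto simp: continuous_map_discrete_iff)
    ultimately show "openin X {x \<in> topspace X. h x \<in> U}"
      by (metis (no_types, lifting) imageE openin_Union)
  qed
qed (use bij compact Hausdorff in \<open>auto simp: bij_betw_def\<close>)

section \<open>The group structure of the topological full group\<close>

lemma in_full_group_iff:
  "g \<in> carrier \<G> \<longleftrightarrow> g \<in> carrier (homeo_group X) \<and>
    (\<exists>c. continuous_map X (discrete_topology UNIV) c \<and> (\<forall>x\<in>topspace X. g x = iterate (c x) x))"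
  by (simp add: topological_full_group_def)

lemma full_groupI:
  assumes c: "continuous_map X (discrete_topology UNIV) (c :: 'a \<Rightarrow> int)"
    and h: "\<And>x. x \<in> topspace X \<Longrightarrow> h x = iterate (c x) x"
    and bij: "bij_betw h (topspace X) (topspace X)"
  shows "restrict h (topspace X) \<in> carrier \<G>"
proof -
  have "bij_betw (restrict h (topspace X)) (topspace X) (topspace X)"
    using bij by (simp add: bij_betw_def inj_on_def)
  then have "homeomorphic_map X X (restrict h (topspace X))"
    using c h by (intro continuous_cocycle_homeomorphic_map[of c]) auto
  then show ?thesis
    using c h \<open>bij_betw (restrict h (topspace X)) _ _\<close>
    by (auto simp: in_full_group_iff carrier_homeo_group Bij_def)
qed

text \<open>Cocycle identities: if \<open>c\<close> and \<open>d\<close> belong to \<open>f\<close>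
  and \<open>g\<close>, then \<open>c (g x) + d x\<close> belongs to the product, and the inverse
  \<open>?g\<close> of \<open>f\<close> has the cocycle \<open>- c (?g x)\<close>.\<close>

lemma subgroup_full_group: "subgroup (carrier \<G>) (homeo_group X)"
proof (rule homeo.subgroupI)
  show "carrier \<G> \<subseteq> carrier (homeo_group X)" by (auto simp: in_full_group_iff)
  have "\<one>\<^bsub>homeo_group X\<^esub> \<in> carrier \<G>"
    by (auto simp: in_full_group_iff one_homeo_group_apply intro!: exI[of _ "\<lambda>_. 0"])
  then show "carrier \<G> \<noteq> {}" by blast
next
  fix f assume f: "f \<in> carrier \<G>"
  then obtain c where c: "continuous_map X (discrete_topology UNIV) c"
    "\<And>x. x \<in> topspace X \<Longrightarrow> f x = iterate (c x) x" and fh: "f \<in> carrier (homeo_group X)"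
    by (auto simp: in_full_group_iff)
  let ?g = "inv\<^bsub>homeo_group X\<^esub> f"
  have gh: "?g \<in> carrier (homeo_group X)" using fh by simp
  have "continuous_map X X ?g"
    using gh homeomorphic_imp_continuous_map by (auto simp: carrier_homeo_group)
  then have "continuous_map X (discrete_topology UNIV) (c \<circ> ?g)"
    using c(1) continuous_map_compose by blast
  then have "continuous_map X (discrete_topology UNIV) (uminus \<circ> (c \<circ> ?g))"
    by (rule continuous_map_compose) auto
  moreover have "?g x = iterate ((uminus \<circ> (c \<circ> ?g)) x) x" if x: "x \<in> topspace X" for x
  proof -
    have gx: "?g x \<in> topspace X" using gh x by (rule homeo_group_apply_in)
    have "x = f (?g x)"
      using mult_homeo_group_apply[OF fh gh x] fh x by (simp add: one_homeo_group_apply)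
    also have "\<dots> = iterate (c (?g x)) (?g x)" using c gx by blast
    finally have "iterate (- c (?g x)) x = iterate (- c (?g x)) (iterate (c (?g x)) (?g x))" by simp
    then show ?thesis using gx by simp
  qed
  ultimately show "?g \<in> carrier \<G>" using gh by (auto simp: in_full_group_iff)
next
  fix f g assume f: "f \<in> carrier \<G>" and g: "g \<in> carrier \<G>"
  then obtain c d where c: "continuous_map X (discrete_topology UNIV) c"
    "\<And>x. x \<in> topspace X \<Longrightarrow> f x = iterate (c x) x" and fh: "f \<in> carrier (homeo_group X)"
    and d: "continuous_map X (discrete_topology UNIV) d"
    "\<And>x. x \<in> topspace X \<Longrightarrow> g x = iterate (d x) x" and gh: "g \<in> carrier (homeo_group X)"
    by (auto simp: in_full_group_iff)
  have "continuous_map X X g"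
    using gh homeomorphic_imp_continuous_map by (auto simp: carrier_homeo_group)
  then have cg: "continuous_map X (discrete_topology UNIV) (c \<circ> g)"
    using c(1) continuous_map_compose by blast
  have "continuous_map X (discrete_topology UNIV) (\<lambda>x. c (g x) + d x)"
    unfolding continuous_map_discrete_iff
  proof
    fix n
    have "{x \<in> topspace X. c (g x) + d x = n} =
      (\<Union>k. {x \<in> topspace X. (c \<circ> g) x = n - k} \<inter> {x \<in> topspace X. d x = k})" by auto
    moreover have "openin X ({x \<in> topspace X. (c \<circ> g) x = n - k} \<inter> {x \<in> topspace X. d x = k})" for k
      using cg d(1) unfolding continuous_map_discrete_iff by blast
    ultimately show "openin X {x \<in> topspace X. c (g x) + d x = n}"
      by (metis (no_types, lifting) imageE openin_Union)
  qed
  moreover have "(f \<otimes>\<^bsub>homeo_group X\<^esub> g) x = iterate (c (g x) + d x) x" if "x \<in> topspace X" for x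
    using that c(2)[of "g x"] d(2)[of x] homeo_group_apply_in[OF gh that]
    by (simp add: mult_homeo_group_apply[OF fh gh])
  ultimately show "f \<otimes>\<^bsub>homeo_group X\<^esub> g \<in> carrier \<G>"
    using fh gh by (auto simp: in_full_group_iff)
qed

lemma full_group_eq: "\<G> = (homeo_group X)\<lparr>carrier := carrier \<G>\<rparr>"
  by (simp add: topological_full_group_def)

sublocale full: group \<G>
  using homeo.subgroup_imp_group[OF subgroup_full_group] full_group_eq by simp

lemma full_homeo: "g \<in> carrier \<G> \<Longrightarrow> g \<in> carrier (homeo_group X)"
  by (simp add: in_full_group_iff)

lemma full_apply_in [simp]: "\<lbrakk>g \<in> carrier \<G>; x \<in> topspace X\<rbrakk> \<Longrightarrow> g x \<in> topspace X"
  using full_homeo homeo_group_apply_in by metis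

lemma mult_full_group: "(\<otimes>\<^bsub>\<G>\<^esub>) = (\<otimes>\<^bsub>homeo_group X\<^esub>)"
  by (simp add: topological_full_group_def)

lemma full_mult_apply [simp]:
  "\<lbrakk>f \<in> carrier \<G>; g \<in> carrier \<G>; x \<in> topspace X\<rbrakk> \<Longrightarrow> (f \<otimes>\<^bsub>\<G>\<^esub> g) x = f (g x)"
  unfolding mult_full_group by (intro mult_homeo_group_apply full_homeo)

lemma full_one_apply [simp]: "x \<in> topspace X \<Longrightarrow> \<one>\<^bsub>\<G>\<^esub> x = x"
  by (simp add: topological_full_group_def one_homeo_group_apply)

lemma full_inv_apply:
  assumes "f \<in> carrier \<G>" "x \<in> topspace X" "f x = y"
  shows "(inv\<^bsub>\<G>\<^esub> f) y = x"
proof -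
  have "(inv\<^bsub>\<G>\<^esub> f \<otimes>\<^bsub>\<G>\<^esub> f) x = (inv\<^bsub>\<G>\<^esub> f) (f x)"
    using assms by (intro full_mult_apply) auto
  then show ?thesis using assms by simp
qed

lemma iterate_full: "iterate n \<in> carrier \<G>"
  using iterate_carrier by (auto simp: in_full_group_iff intro!: exI[of _ "\<lambda>_. n"])

lemma commutator_derived:
  "\<lbrakk>f \<in> carrier \<G>; g \<in> carrier \<G>\<rbrakk> \<Longrightarrow> commutator f g \<in> derived \<G> (carrier \<G>)"
  unfolding derived_def by (rule generate.incl) blast

text \<open>The commutator is \<open>f\<close> after the conjugate of the inverse of
  \<open>f\<close> by \<open>iterate n\<close>, and \<open>fix_\<close> says that this conjugate
  fixes \<open>x\<close>.\<close>

lemma commutator_apply: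
  assumes f: "f \<in> carrier \<G>" and x: "x \<in> topspace X"
    and fix_: "f (iterate (- n) x) = iterate (- n) x"
  shows "commutator f (iterate n) x = f x"
proof -
  have "(inv\<^bsub>\<G>\<^esub> (iterate n)) x = iterate (- n) x"
    using x by (intro full_inv_apply iterate_full) auto
  moreover have "(inv\<^bsub>\<G>\<^esub> f) (iterate (- n) x) = iterate (- n) x"
    using f x fix_ by (intro full_inv_apply) auto
  ultimately show ?thesis using f x by (simp add: iterate_full)
qed

end

section \<open>A lamplighter action over the first return map\<close>

context cantor_minimal
begin

definition swap_map :: "'a set \<Rightarrow> 'a \<Rightarrow> 'a" where
  "swap_map U = (\<lambda>x\<in>topspace X.
     if x \<in> U then iterate 1 x else if iterate (- 1) x \<in> U then iterate (- 1) x else x)"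

text \<open>If \<open>U\<close> is disjoint from its first three translates, this exchanges
  \<open>U\<close> with its first translate and the second with the third. The commutator puts the
  swap into the commutator subgroup, and the exponent 2 keeps the extra swap away from the first
  pair.\<close>

definition double_swap :: "'a set \<Rightarrow> 'a \<Rightarrow> 'a" where
  "double_swap U = commutator (swap_map U) (iterate 2)"

lemma swap_map_full:
  assumes U: "clopenin X U" and disj: "\<And>y. y \<in> U \<Longrightarrow> iterate 1 y \<notin> U"
  shows "swap_map U \<in> carrier \<G>"
  unfolding swap_map_def
proof (rule full_groupI)
  let ?V = "{x \<in> topspace X. iterate (- 1) x \<in> U}"
  let ?h = "\<lambda>x. if x \<in> U then iterate 1 x else if iterate (- 1) x \<in> U then iterate (- 1) x else x"
  have UX: "U \<subseteq> topspace X" using U by (rule clopenin_subset)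
  show "continuous_map X (discrete_topology UNIV)
      (\<lambda>x. if x \<in> U then 1 else if x \<in> ?V then - 1 else 0)"
    using U by (intro continuous_map_discrete_If clopenin_iterate_preimage) auto
  show "?h x = iterate (if x \<in> U then 1 else if x \<in> ?V then - 1 else 0) x" if "x \<in> topspace X" for x
    using that by simp
  \<comment> \<open>By \<open>disj\<close> the swap is an involution, so it witnesses its own
    bijectivity.\<close>
  have "?h (?h x) = x" if "x \<in> topspace X" for x
    using that UX disj by auto
  then show "bij_betw ?h (topspace X) (topspace X)"
    by (intro bij_betw_byWitness[where f' = ?h]) auto
qed

lemma double_swap_derived:
  "\<lbrakk>clopenin X U; \<And>y. y \<in> U \<Longrightarrow> iterate 1 y \<notin> U\<rbrakk> \<Longrightarrow> double_swap U \<in> derived \<G> (carrier \<G>)"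
  unfolding double_swap_def by (intro commutator_derived swap_map_full iterate_full)

text \<open>The two conditions on \<open>x\<close> say that \<open>swap_map U\<close> fixes
  \<open>iterate (- 2) x\<close>, as \<open>commutator_apply\<close> requires.\<close>

lemma double_swap_apply:
  assumes "clopenin X U" "\<And>y. y \<in> U \<Longrightarrow> iterate 1 y \<notin> U"
    and x: "x \<in> topspace X" "iterate (- 2) x \<notin> U" "iterate (- 3) x \<notin> U"
  shows "double_swap U x = swap_map U x"
  unfolding double_swap_def using x swap_map_full[OF assms(1,2)]
  by (intro commutator_apply) (auto simp: swap_map_def)

section \<open>The commutator subgroup as a group of its own\<close>

sublocale derived: group "commutator_subgroup \<G>"
  unfolding commutator_subgroup_def
  by (intro full.subgroup_imp_group full.derived_is_subgroup order_refl)

lemma carrier_derived: "carrier (commutator_subgroup \<G>) = derived \<G> (carrier \<G>)"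
  by (simp add: commutator_subgroup_def)

lemma derived_full: "g \<in> derived \<G> (carrier \<G>) \<Longrightarrow> g \<in> carrier \<G>"
  using full.derived_in_carrier[OF order_refl] by blast

lemma derived_apply_in [simp]:
  "\<lbrakk>g \<in> derived \<G> (carrier \<G>); x \<in> topspace X\<rbrakk> \<Longrightarrow> g x \<in> topspace X"
  using derived_full by simp

lemma derived_mult_apply [simp]:
  "\<lbrakk>f \<in> derived \<G> (carrier \<G>); g \<in> derived \<G> (carrier \<G>); x \<in> topspace X\<rbrakk>
    \<Longrightarrow> (f \<otimes>\<^bsub>commutator_subgroup \<G>\<^esub> g) x = f (g x)"
  by (simp add: commutator_subgroup_def derived_full)

lemma derived_one_apply [simp]: "x \<in> topspace X \<Longrightarrow> \<one>\<^bsub>commutator_subgroup \<G>\<^esub> x = x"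
  by (simp add: commutator_subgroup_def)

text \<open>Commuting with a fixed power of \<phi> passes to products and inverses, so it can be
  checked on generators.\<close>

lemma derived_commutes_iterate:
  assumes S: "S \<subseteq> derived \<G> (carrier \<G>)"
      "generate (commutator_subgroup \<G>) S = carrier (commutator_subgroup \<G>)"
    and comm: "\<And>s x. \<lbrakk>s \<in> S; x \<in> topspace X\<rbrakk> \<Longrightarrow> s (iterate n x) = iterate n (s x)"
    and g: "g \<in> derived \<G> (carrier \<G>)" and "x \<in> topspace X"
  shows "g (iterate n x) = iterate n (g x)"
proof -
  have gen: "h \<in> carrier (commutator_subgroup \<G>)" if "h \<in> generate (commutator_subgroup \<G>) S" for h
    using that S by simp
  have "g \<in> generate (commutator_subgroup \<G>) S"
    using g S by (simp add: carrier_derived)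
  then show ?thesis using \<open>x \<in> topspace X\<close>
  proof (induction arbitrary: x rule: generate.induct)
    case (incl h)
    then show ?case using comm by blast
  next
    case (inv h)
    let ?k = "inv\<^bsub>commutator_subgroup \<G>\<^esub> h"
    have h: "h \<in> derived \<G> (carrier \<G>)" and k: "?k \<in> derived \<G> (carrier \<G>)"
      using inv S derived.inv_closed by (auto simp: carrier_derived)
    have hk: "h (?k y) = y" if "y \<in> topspace X" for y
      using derived_mult_apply[OF h k that] derived.r_inv[of h] h that by (simp add: carrier_derived)
    have kh: "?k (h y) = y" if "y \<in> topspace X" for y
      using derived_mult_apply[OF k h that] derived.l_inv[of h] h that by (simp add: carrier_derived)
    have "?k (iterate n x) = ?k (iterate n (h (?k x)))"
      using hk inv by simp
    also have "\<dots> = ?k (h (iterate n (?k x)))"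
      using comm inv k by simp
    also have "\<dots> = iterate n (?k x)"
      using kh k inv by simp
    finally show ?case .
  next
    case (eng h1 h2)
    then show ?case using gen by (simp add: carrier_derived)
  qed simp
qed

end

text \<open>Three translates are what is needed for \<open>C\<close> and its first translate to be
  disjoint from each other and from their images under \<open>iterate (- 2)\<close>.\<close>

locale return_system = cantor_minimal +
  fixes C
  assumes C: "clopenin X C" "C \<noteq> {}"
    and translate_disjoint: "\<And>j y. \<lbrakk>j \<in> {1, 2, 3}; y \<in> C\<rbrakk> \<Longrightarrow> iterate j y \<notin> C"
begin

lemma C_subset: "y \<in> C \<Longrightarrow> y \<in> topspace X"
  using C clopenin_subset by blast

lemma translate_disjoint_neg:
  assumes "j \<in> {1, 2, 3}" "y \<in> C"
  shows "iterate (- j) y \<notin> C"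
  using translate_disjoint[OF assms(1), of "iterate (- j) y"] assms C_subset by auto

section \<open>The first return map to \<open>C\<close>\<close>

definition return_time :: "'a \<Rightarrow> nat" where
  "return_time y = (LEAST n. 1 \<le> n \<and> iterate (int n) y \<in> C)"

definition return_map :: "'a \<Rightarrow> 'a" where
  "return_map y = iterate (int (return_time y)) y"

lemma return_time:
  assumes "y \<in> topspace X"
  shows "1 \<le> return_time y" "return_map y \<in> C"
    and "\<lbrakk>1 \<le> n; iterate (int n) y \<in> C\<rbrakk> \<Longrightarrow> return_time y \<le> n"
proof -
  have "\<exists>n. 1 \<le> n \<and> iterate (int n) y \<in> C"
    using bounded_hitting_time[of C] C assms by (metis clopenin_def)
  from LeastI_ex[OF this] show "1 \<le> return_time y" "return_map y \<in> C"
    by (auto simp: return_time_def return_map_def)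
  show "return_time y \<le> n" if "1 \<le> n" "iterate (int n) y \<in> C"
    unfolding return_time_def using that by (intro Least_le) simp
qed

lemma return_time_bounded:
  obtains N where "\<And>y. y \<in> topspace X \<Longrightarrow> return_time y \<le> N"
  using bounded_hitting_time[of C] C return_time(3) by (metis clopenin_def order_trans)

text \<open>If two points return to the same point, the one with the larger return time passes
  through the other one on the way, and so would have returned earlier.\<close>

lemma return_map_inj: "inj_on return_map C"
proof -
  have *: "y = z" if "y \<in> C" "z \<in> C" "return_map y = return_map z" "return_time y \<le> return_time z" for y z
  proof (rule ccontr)
    assume "y \<noteq> z"
    have "iterate (- int (return_time y)) (return_map y) = iterate (- int (return_time y)) (return_map z)"
      using that by simp
    then have y: "y = iterate (int (return_time z - return_time y)) z"
      using that C_subset by (simp add: return_map_def of_nat_diff)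
    then have "return_time z - return_time y \<noteq> 0"
      using \<open>y \<noteq> z\<close> C_subset[OF that(2)] by (metis iterate_0 of_nat_0)
    then have "return_time z \<le> return_time z - return_time y"
      using y that C_subset by (intro return_time(3)) auto
    moreover have "return_time y \<ge> 1" using that C_subset return_time by blast
    ultimately show False using \<open>return_time z - return_time y \<noteq> 0\<close> by simp
  qed
  show ?thesis
    by (rule inj_onI) (metis * nle_le)
qed

text \<open>The preimage of \<open>z\<close> is the most recent earlier visit of its orbit to
  \<open>C\<close>.\<close>

lemma return_map_image: "return_map ` C = C"
proof
  show "return_map ` C \<subseteq> C" using return_time(2) C_subset by blast
  show "C \<subseteq> return_map ` C"
  proof
    fix z assume z: "z \<in> C"
    let ?P = "\<lambda>n. 1 \<le> n \<and> iterate (- int n) z \<in> C"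
    have "\<exists>n. ?P n"
    proof -
      obtain N :: nat where N: "\<And>x. x \<in> topspace X \<Longrightarrow> \<exists>n. 1 \<le> n \<and> n \<le> N \<and> iterate (int n) x \<in> C"
        using bounded_hitting_time[of C] C by (metis clopenin_def)
      \<comment> \<open>Starting \<open>N + 1\<close> steps before \<open>z\<close>, the orbit meets
        \<open>C\<close> within \<open>N\<close> steps, that is, strictly before reaching
        \<open>z\<close>.\<close>
      obtain n where n: "1 \<le> n" "n \<le> N" "iterate (int n) (iterate (- int N - 1) z) \<in> C"
        using N z C_subset by (meson iterate_in)
      then have "?P (N + 1 - n)"
        using C_subset[OF z] by (simp add: of_nat_diff algebra_simps)
      then show ?thesis by blast
    qed
    define n where "n = (LEAST n. ?P n)"
    have n: "?P n" unfolding n_def by (rule LeastI_ex) fact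
    have min: "n \<le> m" if "?P m" for m unfolding n_def using that by (rule Least_le)
    let ?y = "iterate (- int n) z"
    have yX: "?y \<in> topspace X" using z C_subset by simp
    have "return_time ?y \<le> n"
      using n z C_subset by (intro return_time(3)[OF yX]) auto
    \<comment> \<open>An earlier return would be a visit to \<open>C\<close> closer to
      \<open>z\<close>, against minimality of \<open>n\<close>.\<close>
    moreover have "\<not> return_time ?y < n"
    proof
      assume less: "return_time ?y < n"
      have "iterate (- int (n - return_time ?y)) z = return_map ?y"
        using z C_subset less by (simp add: return_map_def of_nat_diff)
      then have "?P (n - return_time ?y)"
        using return_time(2)[OF yX] less by simp
      then show False using min[of "n - return_time ?y"] less return_time(1)[OF yX] by simp
    qed
    ultimately have "return_map ?y = z"
      using z C_subset by (simp add: return_map_def)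
    then show "z \<in> return_map ` C" using n by (metis imageI)
  qed
qed

lemma return_map_in: "y \<in> C \<Longrightarrow> (return_map ^^ p) y \<in> C"
  using return_map_image by (induction p) auto

text \<open>For \<open>n \<ge> 1\<close> the level set is the set of points in \<open>C\<close> at
  time \<open>n\<close>, minus those in \<open>C\<close> at the finitely many positive times before;
  all these sets are clopen.\<close>

lemma continuous_return_time: "continuous_map X (discrete_topology UNIV) return_time"
  unfolding continuous_map_discrete_iff
proof
  fix n
  let ?P = "\<lambda>m. {x \<in> topspace X. iterate (int m) x \<in> C}"
  show "openin X {x \<in> topspace X. return_time x = n}"
  proof (cases "n \<ge> 1")
    case True
    have "return_time x = n \<longleftrightarrow> x \<in> ?P n - (\<Union>m\<in>{1..<n}. ?P m)" if x: "x \<in> topspace X" for x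
    proof
      assume "return_time x = n"
      then show "x \<in> ?P n - (\<Union>m\<in>{1..<n}. ?P m)"
        using return_time[OF x] x by (fastforce simp: return_map_def)
    next
      assume A: "x \<in> ?P n - (\<Union>m\<in>{1..<n}. ?P m)"
      then have "return_time x \<le> n" using return_time(3)[OF x] True by auto
      moreover have "\<not> return_time x < n"
        using A return_time(1,2)[OF x] x by (auto simp: return_map_def)
      ultimately show "return_time x = n" by simp
    qed
    then have "{x \<in> topspace X. return_time x = n} = ?P n - (\<Union>m\<in>{1..<n}. ?P m)"
      by blast
    moreover have "openin X (?P n - (\<Union>m\<in>{1..<n}. ?P m))"
      using clopenin_iterate_preimage[OF C(1)] unfolding clopenin_def
      by (intro openin_diff closedin_Union) auto
    ultimately show ?thesis by simp
  next
    case False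
    then have "{x \<in> topspace X. return_time x = n} = {}"
      using return_time(1) by fastforce
    then show ?thesis by (simp only: openin_empty)
  qed
qed

section \<open>Lamplighter words on two sheets over \<open>C\<close>\<close>

definition first_return :: "'a \<Rightarrow> 'a" where
  "first_return = (\<lambda>x\<in>topspace X. if x \<in> C then return_map x else x)"

lemma first_return_full: "first_return \<in> carrier \<G>"
  unfolding first_return_def
proof (rule full_groupI)
  have "continuous_map X (discrete_topology UNIV) (int \<circ> return_time)"
    using continuous_return_time by (rule continuous_map_compose) auto
  with C(1) show "continuous_map X (discrete_topology UNIV) (\<lambda>x. if x \<in> C then (int \<circ> return_time) x else 0)"
    by (rule continuous_map_discrete_If) simp
  show "(if x \<in> C then return_map x else x) = iterate (if x \<in> C then (int \<circ> return_time) x else 0) x"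
    if "x \<in> topspace X" for x
    using that by (simp add: return_map_def)
  have "bij_betw (\<lambda>x. if x \<in> C then return_map x else x) (C \<union> (topspace X - C)) (C \<union> (topspace X - C))"
    using return_map_inj return_map_image
    by (intro bij_betw_disjoint_Un) (auto simp: bij_betw_def inj_on_def)
  moreover have "C \<union> (topspace X - C) = topspace X" using C_subset by blast
  ultimately show "bij_betw (\<lambda>x. if x \<in> C then return_map x else x) (topspace X) (topspace X)" by simp
qed

text \<open>The second factor is the conjugate of \<open>first_return\<close> by \<phi>, so the
  product performs the first return on \<open>C\<close> and its copy on the first translate.\<close>

definition doubled_return :: "'a \<Rightarrow> 'a" where
  "doubled_return = first_return \<otimes>\<^bsub>\<G>\<^esub> (iterate 1 \<otimes>\<^bsub>\<G>\<^esub> (first_return \<otimes>\<^bsub>\<G>\<^esub> iterate (- 1)))"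

definition shift :: "'a \<Rightarrow> 'a" where
  "shift = commutator doubled_return (iterate 2)"

lemma doubled_return_full: "doubled_return \<in> carrier \<G>"
  unfolding doubled_return_def using first_return_full iterate_full by simp

lemma doubled_return_apply:
  "x \<in> topspace X \<Longrightarrow>
    doubled_return x = first_return (iterate 1 (first_return (iterate (- 1) x)))"
  unfolding doubled_return_def using first_return_full iterate_full by simp

lemma first_return_outside: "\<lbrakk>x \<in> topspace X; x \<notin> C\<rbrakk> \<Longrightarrow> first_return x = x"
  by (simp add: first_return_def)

lemma first_return_inside: "x \<in> C \<Longrightarrow> first_return x = return_map x"
  using C_subset by (simp add: first_return_def)

lemma shift_derived: "shift \<in> derived \<G> (carrier \<G>)"
  unfolding shift_def by (intro commutator_derived doubled_return_full iterate_full)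

definition sheet :: "bool \<Rightarrow> 'a \<Rightarrow> 'a" where
  "sheet e y = (if e then iterate 1 y else y)"

lemma sheet_in: "y \<in> C \<Longrightarrow> sheet e y \<in> topspace X"
  using C_subset by (simp add: sheet_def)

text \<open>Only the sheet is recovered: it carries the parity that distinguishes the words.\<close>

lemma sheet_inject:
  assumes "y \<in> C" "z \<in> C" "sheet e y = sheet e' z"
  shows "e = e'"
proof -
  have "iterate 1 y \<noteq> z" "iterate 1 z \<noteq> y"
    using translate_disjoint[of 1] assms by auto
  then show ?thesis using assms by (auto simp: sheet_def split: if_splits)
qed

lemma shift_sheet:
  assumes y: "y \<in> C"
  shows "shift (sheet e y) = sheet e (return_map y)"
proof -
  have yX: "y \<in> topspace X" using y C_subset by blast
  have Ry: "return_map y \<in> C" "return_map y \<in> topspace X"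
    using return_time(2)[OF yX] C_subset by auto
  have out: "iterate (- 1) y \<notin> C" "iterate (- 2) y \<notin> C" "iterate (- 3) y \<notin> C"
    "iterate 1 (return_map y) \<notin> C"
    using y Ry translate_disjoint_neg[of 1] translate_disjoint_neg[of 2] translate_disjoint_neg[of 3]
      translate_disjoint[of 1] by auto
  \<comment> \<open>On a point \<open>w\<close>, \<open>doubled_return\<close> acts nontrivially
    only if \<open>w\<close> or \<open>iterate (- 1) w\<close> lies in \<open>C\<close>; over both
    sheets this concerns the translates of \<open>y\<close> by -1, -2 and -3.\<close>
  have "doubled_return (iterate (- 2) (sheet e y)) = iterate (- 2) (sheet e y)"
    using yX out by (cases e) (auto simp: sheet_def doubled_return_apply first_return_outside)
  then have "shift (sheet e y) = doubled_return (sheet e y)"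
    unfolding shift_def by (intro commutator_apply doubled_return_full sheet_in y)
  also have "\<dots> = sheet e (return_map y)"
    using y yX Ry out
    by (cases e) (auto simp: sheet_def doubled_return_apply first_return_outside first_return_inside)
  finally show ?thesis .
qed

lemma double_swap_sheet:
  assumes U: "clopenin X U" "U \<subseteq> C" and y: "y \<in> C"
  shows "double_swap U (sheet e y) = sheet (e \<noteq> (y \<in> U)) y"
proof -
  have yX: "y \<in> topspace X" using y C_subset by blast
  have out: "iterate (- 1) y \<notin> U" "iterate (- 2) y \<notin> U" "iterate (- 3) y \<notin> U" "iterate 1 y \<notin> U"
    using y U(2) translate_disjoint_neg[of 1] translate_disjoint_neg[of 2] translate_disjoint_neg[of 3]
      translate_disjoint[of 1] by auto
  have "double_swap U (sheet e y) = swap_map U (sheet e y)"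
    using U yX out translate_disjoint[of 1] y
    by (intro double_swap_apply sheet_in) (auto simp: sheet_def)
  also have "\<dots> = sheet (e \<noteq> (y \<in> U)) y"
    using yX out by (cases e) (auto simp: sheet_def swap_map_def)
  finally show ?thesis .
qed

text \<open>Each \<open>shift\<close> advances the base point by one return, and the swap inserted
  at time \<open>k\<close> toggles the sheet exactly when the base point is then in
  \<open>U\<close>. Starting on the lower sheet, the final sheet is the parity of the
  toggles.\<close>

lemma subset_word_sheet:
  assumes U: "clopenin X U" "U \<subseteq> C" and y: "y \<in> C"
  shows "derived.subset_word shift (double_swap U) A n y =
    sheet (odd (card {k \<in> A \<inter> {..<n}. (return_map ^^ k) y \<in> U})) ((return_map ^^ n) y)"
proof (induction n)
  case 0
  then show ?case using y C_subset by (simp add: sheet_def)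
next
  case (Suc n)
  let ?w = "derived.subset_word shift (double_swap U) A n"
  let ?K = "\<lambda>n. {k \<in> A \<inter> {..<n}. (return_map ^^ k) y \<in> U}"
  let ?t = "if n \<in> A then double_swap U else \<one>\<^bsub>commutator_subgroup \<G>\<^esub>"
  have yX: "y \<in> topspace X" using y C_subset by blast
  have ds: "double_swap U \<in> derived \<G> (carrier \<G>)"
    using U translate_disjoint[of 1] by (intro double_swap_derived) auto
  have w: "?w \<in> derived \<G> (carrier \<G>)"
    using derived.subset_word_closed[of shift "double_swap U" A n] ds shift_derived
    by (simp add: carrier_derived)
  have t: "?t \<in> derived \<G> (carrier \<G>)"
    using ds derived.one_closed by (simp add: carrier_derived)
  have tw: "?t \<otimes>\<^bsub>commutator_subgroup \<G>\<^esub> ?w \<in> derived \<G> (carrier \<G>)"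
    using t w derived.m_closed by (simp add: carrier_derived)
  have K: "?K (Suc n) = ?K n \<union> (if n \<in> A \<and> (return_map ^^ n) y \<in> U then {n} else {})"
    by (auto simp: less_Suc_eq)
  have card: "odd (card (?K (Suc n))) = (odd (card (?K n)) \<noteq> (n \<in> A \<and> (return_map ^^ n) y \<in> U))"
    unfolding K by (auto simp: card_insert_if)
  have Rn: "(return_map ^^ n) y \<in> C" using return_map_in y by blast
  have "derived.subset_word shift (double_swap U) A (Suc n) y = shift (?t (?w y))"
    using shift_derived t w tw yX by simp
  also have "\<dots> = shift (?t (sheet (odd (card (?K n))) ((return_map ^^ n) y)))"
    using Suc by simp
  also have "?t (sheet (odd (card (?K n))) ((return_map ^^ n) y)) =
      sheet (odd (card (?K (Suc n)))) ((return_map ^^ n) y)"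
    using double_swap_sheet[OF U Rn] sheet_in[OF Rn] unfolding card by simp
  also have "shift \<dots> = sheet (odd (card (?K (Suc n)))) ((return_map ^^ Suc n) y)"
    using shift_sheet[OF Rn] by simp
  finally show ?case .
qed

text \<open>Equal words send each \<open>y\<close> in \<open>C\<close> to the same sheet, so their
  visit parities agree; aperiodicity of \<open>U\<close> then recovers the index set.\<close>

lemma exponential_growth_if_aperiodic:
  assumes fg: "finitely_generated_group (commutator_subgroup \<G>)"
    and U: "clopenin X U" "U \<subseteq> C"
    and aper: "\<And>p. p \<ge> 1 \<Longrightarrow> \<exists>y\<in>C. (y \<in> U) \<noteq> ((return_map ^^ p) y \<in> U)"
  shows "exponential_growth (commutator_subgroup \<G>)"
proof (rule derived.exponential_growth_if_inj_subset_word[OF fg])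
  show "shift \<in> carrier (commutator_subgroup \<G>)"
    using shift_derived by (simp add: carrier_derived)
  show "double_swap U \<in> carrier (commutator_subgroup \<G>)"
    using U translate_disjoint[of 1] unfolding carrier_derived by (intro double_swap_derived) auto
  fix n
  show "inj_on (\<lambda>A. derived.subset_word shift (double_swap U) A n) (Pow {..<n})"
  proof (rule inj_onI)
    fix A B assume AB: "A \<in> Pow {..<n}" "B \<in> Pow {..<n}"
      and eq: "derived.subset_word shift (double_swap U) A n = derived.subset_word shift (double_swap U) B n"
    have int: "A \<inter> {..<n} = A" "B \<inter> {..<n} = B" using AB by auto
    have "odd (card {k\<in>A. (return_map ^^ k) y \<in> U}) = odd (card {k\<in>B. (return_map ^^ k) y \<in> U})"
      if y: "y \<in> C" for y
    proof (rule sheet_inject[OF return_map_in[OF y] return_map_in[OF y]])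
      show "sheet (odd (card {k\<in>A. (return_map ^^ k) y \<in> U})) ((return_map ^^ n) y) =
          sheet (odd (card {k\<in>B. (return_map ^^ k) y \<in> U})) ((return_map ^^ n) y)"
        using subset_word_sheet[OF U y, of A n, unfolded int eq]
          subset_word_sheet[OF U y, of B n, unfolded int]
        by (rule trans[OF sym])
    qed
    then show "A = B"
      using AB by (intro subset_eq_if_visit_parity_eq[OF return_map_image aper, of A n B]) auto
  qed
qed

section \<open>Consequences of periodicity under the return map\<close>

lemma return_map_funpow_iterate:
  assumes "y \<in> C"
  obtains m where "p \<le> m" "(return_map ^^ p) y = iterate (int m) y"
proof -
  have "\<exists>m\<ge>p. (return_map ^^ p) y = iterate (int m) y"
  proof (induction p)
    case 0
    then show ?case using assms C_subset by (intro exI[of _ 0]) simp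
  next
    case (Suc p)
    then obtain m where m: "m \<ge> p" "(return_map ^^ p) y = iterate (int m) y" by blast
    let ?z = "(return_map ^^ p) y"
    \<comment> \<open>Each return takes at least one step, which preserves the bound
      \<open>p \<le> m\<close>; later this makes \<open>m\<close> positive.\<close>
    have "return_time ?z \<ge> 1"
      using return_time(1) return_map_in[OF assms] C_subset by blast
    moreover have "return_map ?z = iterate (int (return_time ?z)) ?z"
      by (rule return_map_def)
    ultimately show ?case
      using m C_subset[OF assms] by (intro exI[of _ "return_time ?z + m"]) simp
  qed
  then show ?thesis using that by blast
qed

text \<open>Periods are multiplied: a multiple of a period of a set is again a period of it.\<close>

lemma common_period:
  assumes per: "\<And>U. \<lbrakk>clopenin X U; U \<subseteq> C\<rbrakk> \<Longrightarrow>
      \<exists>p\<ge>1. \<forall>y\<in>C. (y \<in> U) = ((return_map ^^ p) y \<in> U)"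
    and \<U>: "finite \<U>" "\<And>U. U \<in> \<U> \<Longrightarrow> clopenin X U \<and> U \<subseteq> C"
  shows "\<exists>p\<ge>1. \<forall>U\<in>\<U>. \<forall>y\<in>C. (y \<in> U) = ((return_map ^^ p) y \<in> U)"
  using \<U>
proof (induction \<U>)
  case empty
  then show ?case by auto
next
  case (insert U \<U>)
  have mult: "(y \<in> V) = ((return_map ^^ (p * q)) y \<in> V)"
    if "\<And>y. y \<in> C \<Longrightarrow> (y \<in> V) = ((return_map ^^ p) y \<in> V)" "y \<in> C" for p q y V
  proof (induction q)
    case (Suc q)
    have "(return_map ^^ (p * Suc q)) y = (return_map ^^ p) ((return_map ^^ (p * q)) y)"
      by (simp add: funpow_add)
    then show ?case using Suc that return_map_in[OF \<open>y \<in> C\<close>] by metis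
  qed simp
  have "\<exists>p\<ge>1. \<forall>U\<in>\<U>. \<forall>y\<in>C. (y \<in> U) = ((return_map ^^ p) y \<in> U)"
    by (rule insert.IH) (simp add: insert.prems)
  then obtain p where p: "p \<ge> 1"
      "\<forall>V\<in>\<U>. \<forall>y\<in>C. (y \<in> V) = ((return_map ^^ p) y \<in> V)" by (elim exE conjE)
  have "\<exists>q\<ge>1. \<forall>y\<in>C. (y \<in> U) = ((return_map ^^ q) y \<in> U)"
    by (rule per) (simp_all add: insert.prems)
  then obtain q where q: "q \<ge> 1" "\<forall>y\<in>C. (y \<in> U) = ((return_map ^^ q) y \<in> U)"
    by (elim exE conjE)
  have "(y \<in> V) = ((return_map ^^ (p * q)) y \<in> V)" if "V \<in> insert U \<U>" "y \<in> C" for V y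
  proof (cases "V = U")
    case True
    have "(y \<in> U) = ((return_map ^^ (q * p)) y \<in> U)"
      by (rule mult[OF _ that(2)]) (rule bspec[OF q(2)])
    then show ?thesis by (simp only: True mult.commute)
  next
    case False
    then have "V \<in> \<U>" using that(1) by simp
    show ?thesis by (rule mult[OF _ that(2)]) (rule bspec[OF bspec[OF p(2) \<open>V \<in> \<U>\<close>]])
  qed
  then have "\<forall>V\<in>insert U \<U>. \<forall>y\<in>C. (y \<in> V) = ((return_map ^^ (p * q)) y \<in> V)"
    by (intro ballI)
  moreover have "p * q \<ge> 1" using p(1) q(1) by simp
  ultimately show ?case by (intro exI[of _ "p * q"] conjI)
qed

text \<open>By compactness, finitely many clopen subsets of \<open>C\<close> record the return time
  and the values of each \<open>c\<close> up to the next return. A common period \<open>p\<close>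
  makes the forward orbits of \<open>y\<close> and \<open>(return_map ^^ p) y\<close> look alike to
  every \<open>c\<close>; the second point is \<open>iterate (int m) y\<close>, and recurrence
  spreads the resulting period \<open>m\<close> to all points.\<close>

lemma common_cocycle_period:
  assumes per: "\<And>U. \<lbrakk>clopenin X U; U \<subseteq> C\<rbrakk> \<Longrightarrow>
      \<exists>p\<ge>1. \<forall>y\<in>C. (y \<in> U) = ((return_map ^^ p) y \<in> U)"
    and \<C>: "finite \<C>" "\<And>c. c \<in> \<C> \<Longrightarrow> continuous_map X (discrete_topology UNIV) (c :: 'a \<Rightarrow> int)"
  shows "\<exists>m::nat. m \<ge> 1 \<and> (\<forall>c\<in>\<C>. \<forall>x\<in>topspace X. c (iterate (int m) x) = c x)"
proof -
  obtain N where N: "\<And>y. y \<in> topspace X \<Longrightarrow> return_time y \<le> N"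
    using return_time_bounded by metis
  \<comment> \<open>Offsets up to \<open>N\<close> suffice, since every return occurs within
    \<open>N\<close> steps.\<close>
  define \<D> where "\<D> = insert (int \<circ> return_time) ((\<lambda>(c, j). c \<circ> iterate (int j)) ` (\<C> \<times> {..N}))"
  have \<D>: "finite \<D>" using \<C> by (simp add: \<D>_def)
  have cont: "continuous_map X (discrete_topology UNIV) d" if "d \<in> \<D>" for d
    using that \<C>(2) continuous_map_compose[OF continuous_iterate]
      continuous_map_compose[OF continuous_return_time, of "discrete_topology UNIV" int]
    by (auto simp: \<D>_def)
  define \<U> where "\<U> = (\<Union>d\<in>\<D>. (\<lambda>n. {x \<in> topspace X. d x \<in> {n}} \<inter> C) ` (d ` topspace X))"
  have fin: "finite \<U>"
    unfolding \<U>_def using \<D> cont compact_space_discrete_image_finite[OF compact] by blast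
  have clopen: "clopenin X U \<and> U \<subseteq> C" if U_in: "U \<in> \<U>" for U
  proof -
    obtain d n where "d \<in> \<D>" and U: "U = {x \<in> topspace X. d x \<in> {n}} \<inter> C"
      using U_in unfolding \<U>_def by blast
    have "clopenin X U"
      unfolding U by (intro clopenin_Int clopenin_preimage_discrete cont C(1)) fact
    then show ?thesis using U by simp
  qed
  have "\<exists>p\<ge>1. \<forall>U\<in>\<U>. \<forall>y\<in>C. (y \<in> U) = ((return_map ^^ p) y \<in> U)"
    using per fin clopen by (rule common_period)
  then obtain p where p: "p \<ge> 1"
      "\<forall>U\<in>\<U>. \<forall>y\<in>C. (y \<in> U) = ((return_map ^^ p) y \<in> U)"
    by (elim exE conjE)
  have d_eq: "d ((return_map ^^ p) y) = d y" if "d \<in> \<D>" "y \<in> C" for d y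
  proof -
    have "{x \<in> topspace X. d x \<in> {d y}} \<inter> C \<in> \<U>"
      using that C_subset by (auto simp: \<U>_def)
    from bspec[OF bspec[OF p(2) this] that(2)]
    have "(return_map ^^ p) y \<in> {x \<in> topspace X. d x \<in> {d y}} \<inter> C"
      using that(2) C_subset by simp
    then show ?thesis by simp
  qed
  have r_eq: "return_time ((return_map ^^ p) y) = return_time y" if "y \<in> C" for y
    using d_eq[of "int \<circ> return_time" y] that by (simp add: \<D>_def)
  \<comment> \<open>For \<open>n\<close> beyond \<open>N\<close>, both points are moved to their
    next return, which takes equally long for both and lowers \<open>n\<close>.\<close>
  have names: "c (iterate (int n) ((return_map ^^ p) y)) = c (iterate (int n) y)"
    if c: "c \<in> \<C>" and "y \<in> C" for c n y
    using \<open>y \<in> C\<close>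
  proof (induction n arbitrary: y rule: less_induct)
    case (less n)
    let ?z = "(return_map ^^ p) y"
    have X: "y \<in> topspace X" "?z \<in> topspace X"
      using less.prems return_map_in C_subset by blast+
    show ?case
    proof (cases "n \<le> N")
      case True
      then have "c \<circ> iterate (int n) \<in> \<D>" using c by (auto simp: \<D>_def)
      from d_eq[OF this less.prems] show ?thesis by simp
    next
      case False
      then have le: "return_time y \<le> n" using N X by (meson le_trans nle_le)
      let ?k = "n - return_time y"
      have "iterate (int n) ?z = iterate (int ?k) (return_map ?z)"
        using X le r_eq[OF less.prems] by (simp add: return_map_def of_nat_diff)
      also have "return_map ?z = (return_map ^^ p) (return_map y)"
        by (simp add: funpow_swap1)
      also have "c (iterate (int ?k) \<dots>) = c (iterate (int ?k) (return_map y))"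
        using less.IH[of ?k "return_map y"] return_time(1,2)[OF X(1)] le by simp
      also have "iterate (int ?k) (return_map y) = iterate (int n) y"
        using X le by (simp add: return_map_def of_nat_diff)
      finally show ?thesis .
    qed
  qed
  obtain y where y: "y \<in> C" using C by blast
  then have yX: "y \<in> topspace X" by (rule C_subset)
  obtain m where m: "p \<le> m" "(return_map ^^ p) y = iterate (int m) y"
    using return_map_funpow_iterate[OF y] by blast
  have "c (iterate (int m) x) = c x" if c: "c \<in> \<C>" and x: "x \<in> topspace X" for c x
  proof (rule ccontr)
    assume neq: "c (iterate (int m) x) \<noteq> c x"
    \<comment> \<open>Throughout this clopen neighbourhood of \<open>x\<close>, \<open>c\<close>
      takes different values at \<open>z\<close> and at \<open>iterate (int m) z\<close>, yet the
      forward orbit of \<open>y\<close> enters it.\<close>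
    let ?W = "{z \<in> topspace X. iterate (int m) z \<in> {z \<in> topspace X. c z \<in> {c (iterate (int m) x)}}}
      \<inter> {z \<in> topspace X. c z \<in> {c x}}"
    have "clopenin X ?W"
      using clopenin_preimage_discrete[OF \<C>(2)[OF c]]
      by (intro clopenin_Int clopenin_iterate_preimage)
    moreover have "x \<in> ?W" using x by simp
    ultimately have "\<exists>n. iterate (int n) y \<in> ?W"
      using yX by (rule forward_orbit_meets_clopen)
    then obtain n where n: "iterate (int n) y \<in> ?W" ..
    have "c (iterate (int m) (iterate (int n) y)) = c (iterate (int n) y)"
      using names[OF c y, of n] m(2) yX by (simp add: add.commute)
    then show False using n neq by simp
  qed
  then show ?thesis using m(1) p(1) by (intro exI[of _ m]) simp
qed

text \<open>Were there no such \<open>U\<close>, a nontrivial power of \<phi> would commute with the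
  whole commutator subgroup; a \<open>double_swap\<close> moving \<open>x\<close> but fixing a
  distant point of its orbit refutes this.\<close>

lemma aperiodic_clopen_exists:
  assumes fg: "finitely_generated_group (commutator_subgroup \<G>)"
  obtains U where "clopenin X U" "U \<subseteq> C"
    "\<And>p. p \<ge> 1 \<Longrightarrow> \<exists>y\<in>C. (y \<in> U) \<noteq> ((return_map ^^ p) y \<in> U)"
proof (rule ccontr)
  note witness = that
  assume no_witness: "\<not> thesis"
  have per: "\<exists>p\<ge>1. \<forall>y\<in>C. (y \<in> U) = ((return_map ^^ p) y \<in> U)"
    if "clopenin X U" "U \<subseteq> C" for U
  proof (rule ccontr)
    assume "\<not> ?thesis"
    then show False using no_witness witness[OF that] by blast
  qed
  obtain S where S: "finite S" "S \<subseteq> derived \<G> (carrier \<G>)"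
      "generate (commutator_subgroup \<G>) S = carrier (commutator_subgroup \<G>)"
    using fg by (auto simp: finitely_generated_group_def carrier_derived)
  have "\<forall>s\<in>S. \<exists>c. continuous_map X (discrete_topology UNIV) c \<and>
      (\<forall>x\<in>topspace X. s x = iterate (c x) x)"
    using S(2) derived_full in_full_group_iff by blast
  from bchoice[OF this] obtain c where c:
    "\<forall>s\<in>S. continuous_map X (discrete_topology UNIV) (c s) \<and>
      (\<forall>x\<in>topspace X. s x = iterate (c s x) x)" ..
  have fin: "finite (c ` S)" using S(1) by simp
  have cont: "continuous_map X (discrete_topology UNIV) d" if "d \<in> c ` S" for d
    using that c by auto
  have "\<exists>m::nat. m \<ge> 1 \<and> (\<forall>d\<in>c ` S. \<forall>x\<in>topspace X. d (iterate (int m) x) = d x)"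
    using per fin cont by (rule common_cocycle_period)
  then obtain m :: nat where m: "m \<ge> 1"
      "\<forall>d\<in>c ` S. \<forall>x\<in>topspace X. d (iterate (int m) x) = d x"
    by (elim exE conjE)
  have comm1: "g (iterate (int m) x) = iterate (int m) (g x)"
    if "g \<in> derived \<G> (carrier \<G>)" "x \<in> topspace X" for g x
  proof (rule derived_commutes_iterate[OF S(2,3) _ that])
    show "s (iterate (int m) x) = iterate (int m) (s x)" if "s \<in> S" "x \<in> topspace X" for s x
    proof -
      have "s (iterate (int m) x) = iterate (c s (iterate (int m) x)) (iterate (int m) x)"
        using c that iterate_in by blast
      also have "c s (iterate (int m) x) = c s x" using m(2) that by simp
      also have "iterate (c s x) (iterate (int m) x) = iterate (int m) (iterate (c s x) x)"
        using that(2) by (simp add: add.commute)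
      also have "iterate (c s x) x = s x" using c that by simp
      finally show ?thesis .
    qed
  qed
  \<comment> \<open>The factor 4 makes \<open>L - 1\<close>, \<open>L - 2\<close> and
    \<open>L - 3\<close> nonzero too.\<close>
  define L where "L = 4 * int m"
  have comm: "g (iterate L x) = iterate L (g x)"
    if g: "g \<in> derived \<G> (carrier \<G>)" and x: "x \<in> topspace X" for g x
  proof -
    have L: "iterate L z = iterate (int m) (iterate (int m) (iterate (int m) (iterate (int m) z)))"
      if "z \<in> topspace X" for z
      using that by (simp add: L_def)
    show ?thesis using g x by (simp only: L comm1 derived_apply_in iterate_in)
  qed
  obtain x where x: "x \<in> topspace X" using nonempty by blast
  \<comment> \<open>The times 1, 2, 3 make the double swap act on \<open>x\<close> as the plain
    swap; \<open>L\<close> to \<open>L - 3\<close> keep \<open>iterate L x\<close> outside both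
    pairs of swapped sets.\<close>
  have "0 \<notin> {1, 2, 3, L, L - 1, L - 2, L - 3}" using m(1) by (auto simp: L_def)
  then obtain U where U: "clopenin X U" "x \<in> U"
      "\<And>j y. \<lbrakk>j \<in> {1, 2, 3, L, L - 1, L - 2, L - 3}; y \<in> U\<rbrakk> \<Longrightarrow> iterate j y \<notin> U"
    using clopen_neighbourhood[OF x] by (metis (no_types, lifting) finite.emptyI finite_insert)
  have disj: "iterate 1 y \<notin> U" if "y \<in> U" for y using U(3) that by blast
  have neg: "iterate (- j) x \<notin> U" if "j \<in> {2, 3}" for j
    using U(3)[of j "iterate (- j) x"] that x U(2) by auto
  have g: "double_swap U \<in> derived \<G> (carrier \<G>)"
    using U(1) disj by (rule double_swap_derived)
  have "double_swap U x = iterate 1 x"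
    using double_swap_apply[OF U(1) disj x] neg U(2) x by (simp add: swap_map_def)
  moreover have "double_swap U (iterate L x) = iterate L x"
    using double_swap_apply[OF U(1) disj, of "iterate L x"] U(2,3) x by (simp add: swap_map_def)
  \<comment> \<open>Commutation would give \<open>iterate L x = iterate (L + 1) x\<close>, against
    freeness.\<close>
  ultimately show False using comm[OF g x] x by simp
qed

end

theorem corollary2p5:
  fixes X :: "'a topology" and \<phi> :: "'a \<Rightarrow> 'a"
  assumes "Cantor_minimal_system X \<phi>"
    and "finitely_generated_group (commutator_subgroup (topological_full_group X \<phi>))"
  shows "exponential_growth (commutator_subgroup (topological_full_group X \<phi>))"
proof -
  interpret cantor_minimal X \<phi> by unfold_locales (rule assms)
  obtain x where "x \<in> topspace X" using nonempty by blast
  then obtain C where C: "clopenin X C" "x \<in> C"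
      "\<And>j y. \<lbrakk>j \<in> {1, 2, 3}; y \<in> C\<rbrakk> \<Longrightarrow> iterate j y \<notin> C"
    using clopen_neighbourhood[of x "{1, 2, 3}"] by auto
  interpret return_system X \<phi> C
    using C by unfold_locales auto
  show ?thesis
    using aperiodic_clopen_exists[OF assms(2)] exponential_growth_if_aperiodic[OF assms(2)] by metis
qed

end
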